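(* Antisymmetric cover systems are dual to subbases of stably locally compact spaces, in the following sense. (a) If $S$ is a subbasis of a stably locally compact space $X$, then $(S,\vdash_\Subset)$ is an antisymmetric cover system, where $F\vdash_\Subset G\Leftrightarrow\bigcap F\Subset\bigcup G$ for $F,G\in\mathsf{F}S$; and $X$ is recovered as its tight spectrum, via the homeomorphism $x\mapsto S_x=\{p\in S:x\in p\}$ from $X$ onto $\mathsf{T}^S$. (b) If $(S,\vdash)$ is an antisymmetric cover system, then $p\mapsto\mathsf{T}_p$ is an injection of $S$ onto a subbasis of the stably locally compact space $\mathsf{T}^S$, and $\vdash$ is recovered as the compact cover relation on this subbasis, i.e. for all $F,G\in\mathsf{F}S$, \[F\vdash G\quad\Leftrightarrow\quad\bigcap_{f\in F}\mathsf{T}_f\Subset\bigcup_{g\in G}\mathsf{T}_g .\]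
   Context: $\mathsf{F}S$ is the set of finite subsets of $S$ (including $\emptyset$). For $\mathcal{F}\subseteq\mathsf{F}S$, $\mathcal{F}_\between=\{G\in\mathsf{F}S: G\cap F\neq\emptyset\text{ for all }F\in\mathcal{F}\}$. For $\mathcal{F},\mathcal{G}\in\mathsf{F}\mathsf{F}S$, $\mathcal{F}\bowtie\mathcal{G}$ means every element of $\mathcal{F}_\between$ contains some element of $\mathcal{G}$ as a subset. For relations $\vdash,\vDash$ on $\mathsf{F}S$, $F\vdash\bullet\vDash G$ iff there are $\mathcal{F},\mathcal{G}\in\mathsf{F}\mathsf{F}S$ with $\mathcal{F}\bowtie\mathcal{G}$, $F\vdash F'$ for all $F'\in\mathcal{F}$, and $G'\vDash G$ for all $G'\in\mathcal{G}$. $F\vdash_{1\exists}G$ iff $F\vdash\{g\}$ for some $g\in G$. $\vdash$ is monotone if $F\vdash G$, $F\subseteq F'$, $G\subseteq G'$ imply $F'\vdash G'$. A strong idempotent is a monotone $\vdash$ with $\vdash\bullet\vdash\ \subseteq\ \vdash\ \subseteq\ \vdash\bullet\vdash_{1\exists}$. Put $\mathsf{B}S=\{F\in\mathsf{F}S:\exists G\in\mathsf{F}S\ (F\vdash G)\}$, and $F\Vdash G$ iff for all $H\in\mathsf{B}S$, if $H\vdash\{f\}$ for all $f\in F$ then $H\vdash G$. A cover relation is a strong idempotent $\vdash$ such that for all $F,G,H\in\mathsf{F}S$: if $F\Vdash H$ and $\{h\}\cup F\vdash G$ for all $h\in H$, then $F\vdash G$. A cover system is a pair $(S,\vdash)$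 with $\vdash$ a cover relation on $\mathsf{F}S$; it is antisymmetric if $\{p\}\Vdash\{q\}$ and $\{q\}\Vdash\{p\}$ imply $p=q$, for $p,q\in S$. $T\subseteq S$ is tight if for all $G\in\mathsf{F}S$: ($F\vdash G$ for some finite $F\subseteq T$) iff $T\cap G\neq\emptyset$. The tight spectrum $\mathsf{T}^S$ is the set of all non-empty tight subsets, with the topology generated by the sets $\mathsf{T}_p=\{T\in\mathsf{T}^S:p\in T\}$, $p\in S$. A subbasis is a family of open sets covering the space and generating its topology; empty intersections are the whole space. For subsets $p,q$ of a space, $p\Subset q$ means every open cover of $q$ has a finite subfamily covering $p$. A space is stably locally compact if it is core compact (whenever $x\in p$ open there is an open $q$ with $x\in q\Subset p$), core coherent ($p\Subset q,r$ open imply $p\Subset q\cap r$) and sober (every irreducible closed set is the closure of a unique point). *)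

theory Defs
  imports "HOL-Analysis.Analysis"
begin

section \<open>Cover systems\<close>

text \<open>
  The set of finite subsets of \<open>S\<close> is the library's \<^term>\<open>Fpow S\<close>. A relation on it is represented
  by a binary predicate on sets; every definition below evaluates such a predicate only at arguments
  in \<^term>\<open>Fpow S\<close>, so its values elsewhere are irrelevant.
\<close>

type_synonym 'a entailment = "'a set \<Rightarrow> 'a set \<Rightarrow> bool"

definition selectors :: "'a set \<Rightarrow> 'a set set \<Rightarrow> 'a set set" where
  "selectors S \<F> = {G \<in> Fpow S. \<forall>F\<in>\<F>. G \<inter> F \<noteq> {}}"

definition cross :: "'a set \<Rightarrow> 'a set set \<Rightarrow> 'a set set \<Rightarrow> bool" where
  "cross S \<F> \<G> \<longleftrightarrow> (\<forall>H \<in> selectors S \<F>. \<exists>G\<in>\<G>. G \<subseteq> H)"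

definition cut_comp :: "'a set \<Rightarrow> 'a entailment \<Rightarrow> 'a entailment \<Rightarrow> 'a entailment" where
  "cut_comp S R Q F G \<longleftrightarrow>
     (\<exists>\<F> \<in> Fpow (Fpow S). \<exists>\<G> \<in> Fpow (Fpow S).
        cross S \<F> \<G> \<and> (\<forall>F'\<in>\<F>. R F F') \<and> (\<forall>G'\<in>\<G>. Q G' G))"

definition single_ent :: "'a entailment \<Rightarrow> 'a entailment" where
  "single_ent R F G \<longleftrightarrow> (\<exists>g\<in>G. R F {g})"

definition monotone_ent :: "'a set \<Rightarrow> 'a entailment \<Rightarrow> bool" where
  "monotone_ent S R \<longleftrightarrow>
     (\<forall>F\<in>Fpow S. \<forall>G\<in>Fpow S. \<forall>F'\<in>Fpow S. \<forall>G'\<in>Fpow S.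
        R F G \<and> F \<subseteq> F' \<and> G \<subseteq> G' \<longrightarrow> R F' G')"

definition strong_idempotent :: "'a set \<Rightarrow> 'a entailment \<Rightarrow> bool" where
  "strong_idempotent S R \<longleftrightarrow>
     monotone_ent S R \<and>
     (\<forall>F\<in>Fpow S. \<forall>G\<in>Fpow S. cut_comp S R R F G \<longrightarrow> R F G) \<and>
     (\<forall>F\<in>Fpow S. \<forall>G\<in>Fpow S. R F G \<longrightarrow> cut_comp S R (single_ent R) F G)"

definition bounded_sets :: "'a set \<Rightarrow> 'a entailment \<Rightarrow> 'a set set" where
  "bounded_sets S R = {F \<in> Fpow S. \<exists>G\<in>Fpow S. R F G}"

definition double_ent :: "'a set \<Rightarrow> 'a entailment \<Rightarrow> 'a entailment" where
  "double_ent S R F G \<longleftrightarrow>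
     (\<forall>H \<in> bounded_sets S R. (\<forall>f\<in>F. R H {f}) \<longrightarrow> R H G)"

definition cover_relation :: "'a set \<Rightarrow> 'a entailment \<Rightarrow> bool" where
  "cover_relation S R \<longleftrightarrow>
     strong_idempotent S R \<and>
     (\<forall>F\<in>Fpow S. \<forall>G\<in>Fpow S. \<forall>H\<in>Fpow S.
        double_ent S R F H \<and> (\<forall>h\<in>H. R ({h} \<union> F) G) \<longrightarrow> R F G)"

definition antisymmetric_cover_system :: "'a set \<Rightarrow> 'a entailment \<Rightarrow> bool" where
  "antisymmetric_cover_system S R \<longleftrightarrow>
     cover_relation S R \<and>
     (\<forall>p\<in>S. \<forall>q\<in>S. double_ent S R {p} {q} \<and> double_ent S R {q} {p} \<longrightarrow> p = q)"

section \<open>The tight spectrum\<close>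

definition tight :: "'a set \<Rightarrow> 'a entailment \<Rightarrow> 'a set \<Rightarrow> bool" where
  "tight S R T \<longleftrightarrow>
     T \<subseteq> S \<and> (\<forall>G\<in>Fpow S. (\<exists>F\<in>Fpow T. R F G) \<longleftrightarrow> T \<inter> G \<noteq> {})"

definition tight_points :: "'a set \<Rightarrow> 'a entailment \<Rightarrow> 'a set set" where
  "tight_points S R = {T. T \<noteq> {} \<and> tight S R T}"

definition tight_nbhd :: "'a set \<Rightarrow> 'a entailment \<Rightarrow> 'a \<Rightarrow> 'a set set" where
  "tight_nbhd S R p = {T \<in> tight_points S R. p \<in> T}"

text \<open>
  The points of \<^term>\<open>topology_generated_by \<B>\<close> are those of \<open>\<Union>\<B>\<close>; here this is all of
  \<^term>\<open>tight_points S R\<close> because its members are non-empty subsets of \<open>S\<close>.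
\<close>

definition tight_spectrum :: "'a set \<Rightarrow> 'a entailment \<Rightarrow> 'a set topology" where
  "tight_spectrum S R = topology_generated_by (tight_nbhd S R ` S)"

lemma topspace_tight_spectrum: "topspace (tight_spectrum S R) = tight_points S R"
  unfolding tight_spectrum_def topology_generated_by_topspace
  by (auto simp: tight_nbhd_def tight_points_def tight_def)

section \<open>Stably locally compact spaces\<close>

definition subbasis_of :: "'b topology \<Rightarrow> 'b set set \<Rightarrow> bool" where
  "subbasis_of X \<S> \<longleftrightarrow>
     (\<forall>U\<in>\<S>. openin X U) \<and> \<Union>\<S> = topspace X \<and> topology_generated_by \<S> = X"

definition compactly_below :: "'b topology \<Rightarrow> 'b set \<Rightarrow> 'b set \<Rightarrow> bool" where
  "compactly_below X p q \<longleftrightarrow>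
     p \<subseteq> topspace X \<and> q \<subseteq> topspace X \<and>
     (\<forall>\<U>. (\<forall>U\<in>\<U>. openin X U) \<and> q \<subseteq> \<Union>\<U> \<longrightarrow>
        (\<exists>\<V>\<subseteq>\<U>. finite \<V> \<and> p \<subseteq> \<Union>\<V>))"

definition core_compact_space :: "'b topology \<Rightarrow> bool" where
  "core_compact_space X \<longleftrightarrow>
     (\<forall>p x. openin X p \<and> x \<in> p \<longrightarrow>
        (\<exists>q. openin X q \<and> x \<in> q \<and> compactly_below X q p))"

definition core_coherent_space :: "'b topology \<Rightarrow> bool" where
  "core_coherent_space X \<longleftrightarrow>
     (\<forall>p q r. openin X p \<and> openin X q \<and> openin X r \<and>
        compactly_below X p q \<and> compactly_below X p r \<longrightarrow> compactly_below X p (q \<inter> r))"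

text \<open>As usual, an irreducible closed set is required to be non-empty.\<close>

definition irreducible_closedin :: "'b topology \<Rightarrow> 'b set \<Rightarrow> bool" where
  "irreducible_closedin X C \<longleftrightarrow>
     closedin X C \<and> C \<noteq> {} \<and>
     (\<forall>A B. closedin X A \<and> closedin X B \<and> C = A \<union> B \<longrightarrow> C = A \<or> C = B)"

definition sober_space :: "'b topology \<Rightarrow> bool" where
  "sober_space X \<longleftrightarrow>
     (\<forall>C. irreducible_closedin X C \<longrightarrow> (\<exists>!x. x \<in> topspace X \<and> C = X closure_of {x}))"

definition stably_locally_compact_space :: "'b topology \<Rightarrow> bool" where
  "stably_locally_compact_space X \<longleftrightarrow>
     core_compact_space X \<and> core_coherent_space X \<and> sober_space X"

text \<open>Intersecting with \<^term>\<open>topspace X\<close> makes the empty intersection the whole space.\<close>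

definition compact_cover :: "'b topology \<Rightarrow> 'b set entailment" where
  "compact_cover X F G \<longleftrightarrow> compactly_below X (topspace X \<inter> \<Inter>F) (\<Union>G)"

end

theory Submission
  imports Defs
begin

text \<open>
  Write \<open>F \<turnstile> G\<close> for \<^term>\<open>R F G\<close>, \<open>T\<^sub>p\<close> for \<^term>\<open>tight_nbhd S R p\<close>, and \<open>\<Subset>\<close> for
  \<^const>\<open>compactly_below\<close>.

  From a cover system to a space: the points of the tight spectrum come from a single
  application of Zorn's lemma. If \<open>T\<close> is minimal among the subsets of \<open>S\<close> that meet every finite
  \<open>G\<close> with \<open>H \<turnstile> G\<close>, then \<open>T\<close> is tight (\<open>minimal_transversal_tight\<close>): minimality provides for each
  \<open>t \<in> T\<close> some \<open>G\<close> with \<open>H \<turnstile> G\<close> and \<open>T \<inter> G = {t}\<close>, and such sets can be fed to the cut rule and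
  to the interpolation property of strong idempotents.
  Two consequences carry everything else. First, for bounded \<open>F\<close>, the set \<open>Q\<^sub>F\<close> of tight sets that
  meet every \<open>G\<close> with \<open>F \<turnstile> G\<close> is compact (\<open>compactin_entailed_points\<close>): by Alexander's subbase
  theorem only covers by sets \<open>T\<^sub>p\<close>, \<open>p \<in> P\<close>, matter, and if these cover \<open>Q\<^sub>F\<close> then \<open>S - P\<close> contains no
  minimal transversal, hence is no transversal, so that \<open>F \<turnstile> G\<close> for some finite \<open>G \<subseteq> P\<close>. The sets
  \<open>Q\<^sub>F\<close> lie between \<open>\<Inter>f\<in>F. T\<^sub>f\<close> and \<open>\<Union>g\<in>G. T\<^sub>g\<close> whenever \<open>F \<turnstile> G\<close>, which
  gives \<open>F \<turnstile> G \<Longrightarrow> (\<Inter>f\<in>F. T\<^sub>f) \<Subset> (\<Union>g\<in>G. T\<^sub>g)\<close>,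
  core compactness and core coherence. Second, an inclusion \<open>(\<Inter>f\<in>F. T\<^sub>f) \<subseteq> (\<Union>k\<in>K. T\<^sub>k)\<close> forces
  \<open>double_ent S R F K\<close> (\<open>double_ent_if_tight_box_subset\<close>), because a bounded \<open>H\<close> with \<open>\<not> H \<turnstile> K\<close> has a
  minimal transversal disjoint from \<open>K\<close>. This yields injectivity, and together
  with the cover axiom it recovers \<open>\<turnstile>\<close> from \<open>\<Subset>\<close> (\<open>entails_if_covered_by_tight_boxes\<close>).

  From a space to a cover system: by core compactness, \<open>F \<turnstile> G\<close> can be interpolated by a finite
  union of finite intersections of subbasic sets, each compactly below a member of \<open>G\<close>
  (\<open>subbasis_interpolation\<close>), and finite distributivity turns such a union into the crossing families
  of a strong idempotent. The relation \<open>double_ent S R F H\<close> forces \<open>\<Inter>F \<subseteq> \<Union>H\<close>, from which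
  the cover axiom and antisymmetry are immediate. Finally a tight set \<open>T\<close> determines the closed set of
  points outside \<open>\<Union>(S - T)\<close>; core coherence makes it irreducible, and
  its generic point \<open>x\<close> satisfies \<open>T = {p \<in> S. x \<in> p}\<close> (\<open>tight_is_point\<close>).
\<close>

section \<open>The relation of being compactly below\<close>

lemma compactly_below_mono:
  assumes "compactly_below X p q" "p' \<subseteq> p" "q \<subseteq> q'" "q' \<subseteq> topspace X"
  shows "compactly_below X p' q'"
  using assms unfolding compactly_below_def by (meson order_trans)

lemma compactly_below_imp_subset:
  assumes "compactly_below X p q" "openin X q"
  shows "p \<subseteq> q"
proof -
  have "(\<forall>U\<in>{q}. openin X U) \<and> q \<subseteq> \<Union>{q}" using assms(2) by simp
  then obtain \<V> where "\<V> \<subseteq> {q}" "p \<subseteq> \<Union>\<V>"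
    using assms(1) unfolding compactly_below_def by meson
  then show ?thesis by blast
qed

lemma compactly_below_UN:
  assumes "finite I" and "q \<subseteq> topspace X" and below: "\<And>i. i \<in> I \<Longrightarrow> compactly_below X (P i) q"
  shows "compactly_below X (\<Union>i\<in>I. P i) q"
  unfolding compactly_below_def
proof (intro conjI allI impI)
  show "(\<Union>i\<in>I. P i) \<subseteq> topspace X"
    using below unfolding compactly_below_def by blast
  fix \<U> assume \<U>: "(\<forall>U\<in>\<U>. openin X U) \<and> q \<subseteq> \<Union>\<U>"
  then have "\<forall>i\<in>I. \<exists>\<V>. \<V> \<subseteq> \<U> \<and> finite \<V> \<and> P i \<subseteq> \<Union>\<V>"
    using below unfolding compactly_below_def by meson
  then obtain \<V> where \<V>: "\<And>i. i \<in> I \<Longrightarrow> \<V> i \<subseteq> \<U> \<and> finite (\<V> i) \<and> P i \<subseteq> \<Union>(\<V> i)"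
    by metis
  show "\<exists>\<V>\<subseteq>\<U>. finite \<V> \<and> (\<Union>i\<in>I. P i) \<subseteq> \<Union>\<V>"
    using \<V> \<open>finite I\<close> by (intro exI[of _ "\<Union>i\<in>I. \<V> i"]) fastforce
qed (use assms in auto)

lemma compactly_below_via_compact:
  assumes "compactin X K" "p \<subseteq> K" "K \<subseteq> q" "q \<subseteq> topspace X"
  shows "compactly_below X p q"
  unfolding compactly_below_def
proof (intro conjI allI impI)
  fix \<U> assume \<U>: "(\<forall>U\<in>\<U>. openin X U) \<and> q \<subseteq> \<Union>\<U>"
  then obtain \<V> where "finite \<V>" "\<V> \<subseteq> \<U>" "K \<subseteq> \<Union>\<V>"
    using assms unfolding compactin_def by (metis order_trans)
  then show "\<exists>\<V>\<subseteq>\<U>. finite \<V> \<and> p \<subseteq> \<Union>\<V>"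
    using assms by blast
qed (use assms in auto)

text \<open>
  A union can be exhausted by open sets compactly below one of its members; a finite
  number of these suffices, and the finitely many members of \<open>\<U>\<close> above them do the job. This
  upgrades the inclusion of a finite subcover to the relation \<^const>\<open>compactly_below\<close>.
\<close>

lemma core_compact_finite_subfamily:
  assumes core: "core_compact_space X" and op: "\<And>U. U \<in> \<U> \<Longrightarrow> openin X U"
    and below: "compactly_below X p (\<Union>\<U>)"
  shows "\<exists>\<V>\<subseteq>\<U>. finite \<V> \<and> compactly_below X p (\<Union>\<V>)"
proof -
  define \<W> where "\<W> = {W. openin X W \<and> (\<exists>U\<in>\<U>. compactly_below X W U)}"
  have "\<Union>\<U> \<subseteq> \<Union>\<W>"
  proof
    fix x assume "x \<in> \<Union>\<U>"
    then obtain U where "U \<in> \<U>" "x \<in> U" by blast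
    then obtain W where "openin X W" "x \<in> W" "compactly_below X W U"
      using core op unfolding core_compact_space_def by meson
    then show "x \<in> \<Union>\<W>" using \<open>U \<in> \<U>\<close> unfolding \<W>_def by blast
  qed
  moreover have "\<forall>W\<in>\<W>. openin X W" by (simp add: \<W>_def)
  ultimately obtain \<W>' where \<W>': "\<W>' \<subseteq> \<W>" "finite \<W>'" "p \<subseteq> \<Union>\<W>'"
    using below unfolding compactly_below_def by meson
  have "\<forall>W\<in>\<W>'. \<exists>U\<in>\<U>. compactly_below X W U"
    using \<W>' unfolding \<W>_def by blast
  then obtain f where f: "\<And>W. W \<in> \<W>' \<Longrightarrow> f W \<in> \<U> \<and> compactly_below X W (f W)"
    by metis
  have top: "\<Union>(f ` \<W>') \<subseteq> topspace X"
    using f op openin_subset by fastforce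
  have "compactly_below X (\<Union>W\<in>\<W>'. W) (\<Union>(f ` \<W>'))"
  proof (rule compactly_below_UN[OF \<open>finite \<W>'\<close> top])
    fix W assume "W \<in> \<W>'"
    with f show "compactly_below X W (\<Union>(f ` \<W>'))"
      using compactly_below_mono[OF _ order_refl _ top] by blast
  qed
  then have "compactly_below X p (\<Union>(f ` \<W>'))"
    using \<W>'(3) top by (auto intro: compactly_below_mono)
  moreover have "f ` \<W>' \<subseteq> \<U>" "finite (f ` \<W>')" using f \<W>' by auto
  ultimately show ?thesis by blast
qed

section \<open>Subbases and compactness\<close>

lemma generated_topology_basic_nbhd:
  assumes "openin (topology_generated_by \<S>) U" "x \<in> U"
  shows "\<exists>\<H>. finite \<H> \<and> \<H> \<noteq> {} \<and> \<H> \<subseteq> \<S> \<and> x \<in> \<Inter>\<H> \<and> \<Inter>\<H> \<subseteq> U"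
proof -
  have "generate_topology_on \<S> U"
    using assms openin_topology_generated_by by blast
  then show ?thesis using \<open>x \<in> U\<close>
  proof (induction rule: generate_topology_on.induct)
    case Empty
    then show ?case by simp
  next
    case (Int A B)
    then obtain \<H> \<K> where "finite \<H>" "\<H> \<noteq> {}" "\<H> \<subseteq> \<S>" "x \<in> \<Inter>\<H>" "\<Inter>\<H> \<subseteq> A"
        "finite \<K>" "\<K> \<noteq> {}" "\<K> \<subseteq> \<S>" "x \<in> \<Inter>\<K>" "\<Inter>\<K> \<subseteq> B"
      by blast
    then show ?case by (intro exI[of _ "\<H> \<union> \<K>"]) auto
  next
    case (UN K)
    then obtain k where "k \<in> K" "x \<in> k" by blast
    then obtain \<H> where \<H>: "finite \<H> \<and> \<H> \<noteq> {} \<and> \<H> \<subseteq> \<S> \<and> x \<in> \<Inter>\<H> \<and> \<Inter>\<H> \<subseteq> k"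
      using UN.IH[of k] by meson
    with \<open>k \<in> K\<close> have "\<Inter>\<H> \<subseteq> \<Union>K" by blast
    with \<H> show ?case by meson
  next
    case (Basis s)
    then show ?case by (intro exI[of _ "{s}"]) auto
  qed
qed

text \<open>
  Alexander's subbase theorem for a subset: the traces on \<open>Q\<close> of open sets are open in the topology
  on \<open>Q\<close> generated by the traces of \<open>\<S>\<close>.
\<close>

lemma compactin_generated_topology:
  assumes sub: "Q \<subseteq> \<Union>\<S>"
    and fin: "\<And>\<C>. \<C> \<subseteq> \<S> \<Longrightarrow> Q \<subseteq> \<Union>\<C> \<Longrightarrow> \<exists>\<C>'. finite \<C>' \<and> \<C>' \<subseteq> \<C> \<and> Q \<subseteq> \<Union>\<C>'"
  shows "compactin (topology_generated_by \<S>) Q"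
proof -
  define Y where "Y = topology (arbitrary union_of (finite intersection_of (\<lambda>x. x \<in> \<S>) relative_to Q))"
  have "compact_space Y"
    by (rule Alexander_subbase_alt[OF sub fin]) (auto simp: Y_def)
  have topY: "topspace Y = Q" by (simp add: Y_def)
  have trace: "openin Y (Q \<inter> U)" if "openin (topology_generated_by \<S>) U" for U
  proof -
    have "generate_topology_on \<S> U"
      using that openin_topology_generated_by by blast
    then show ?thesis
    proof (induction rule: generate_topology_on.induct)
      case (Int A B)
      then have "openin Y ((Q \<inter> A) \<inter> (Q \<inter> B))" by (simp only: openin_Int)
      then show ?case by (simp add: Int_ac)
    next
      case (UN K)
      then have "openin Y (\<Union>k\<in>K. Q \<inter> k)" by (intro openin_Union) auto
      then show ?case by (simp only: Int_Union)
    next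
      case (Basis s)
      then show ?case
        unfolding Y_def openin_subbase
        by (intro arbitrary_union_of_inc relative_to_inc finite_intersection_of_inc)
    qed simp
  qed
  show ?thesis
    unfolding compactin_def
  proof (intro conjI allI impI)
    fix \<U> assume \<U>: "Ball \<U> (openin (topology_generated_by \<S>)) \<and> Q \<subseteq> \<Union>\<U>"
    have "\<forall>U\<in>(\<inter>) Q ` \<U>. openin Y U" using \<U> trace by blast
    moreover have "topspace Y \<subseteq> \<Union>((\<inter>) Q ` \<U>)" using \<U> topY by auto
    ultimately have "\<exists>\<F>. finite \<F> \<and> \<F> \<subseteq> (\<inter>) Q ` \<U> \<and> topspace Y \<subseteq> \<Union>\<F>"
      using \<open>compact_space Y\<close> unfolding compact_space_alt by meson
    then obtain \<V> where "finite \<V>" "\<V> \<subseteq> \<U>" "Q \<subseteq> \<Union>((\<inter>) Q ` \<V>)"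
      unfolding topY by (metis finite_subset_image)
    moreover from this have "Q \<subseteq> \<Union>\<V>" by auto
    ultimately show "\<exists>\<F>. finite \<F> \<and> \<F> \<subseteq> \<U> \<and> Q \<subseteq> \<Union>\<F>"
      by meson
  qed (use sub in simp)
qed

section \<open>Irreducible closed sets and sobriety\<close>

text \<open>
  The open-set form of irreducibility, which is how it is verified and used below: open sets
  that meet \<open>C\<close> have a common point in \<open>C\<close>.
\<close>

lemma irreducible_closedin_iff:
  "irreducible_closedin X C \<longleftrightarrow>
     closedin X C \<and> C \<noteq> {} \<and>
     (\<forall>U V. openin X U \<and> openin X V \<and> U \<inter> C \<noteq> {} \<and> V \<inter> C \<noteq> {} \<longrightarrow> U \<inter> V \<inter> C \<noteq> {})"
  (is "_ \<longleftrightarrow> ?R")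
proof
  assume irr: "irreducible_closedin X C"
  then have clo: "closedin X C" and "C \<noteq> {}" by (auto simp: irreducible_closedin_def)
  have "U \<inter> V \<inter> C \<noteq> {}"
    if "openin X U" "openin X V" "U \<inter> C \<noteq> {}" "V \<inter> C \<noteq> {}" for U V
  proof
    assume "U \<inter> V \<inter> C = {}"
    then have "C = (C - U) \<union> (C - V)" by blast
    moreover have "closedin X (C - U)" "closedin X (C - V)" using clo that by auto
    ultimately have "C = C - U \<or> C = C - V"
      using irr unfolding irreducible_closedin_def by blast
    with that show False by blast
  qed
  with clo \<open>C \<noteq> {}\<close> show ?R by blast
next
  assume R: ?R
  have "C = A \<or> C = B" if "closedin X A" "closedin X B" "C = A \<union> B" for A B
  proof (rule ccontr)
    assume "\<not> (C = A \<or> C = B)"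
    moreover have "C \<subseteq> topspace X" using R closedin_subset by blast
    ultimately have "(topspace X - A) \<inter> C \<noteq> {}" "(topspace X - B) \<inter> C \<noteq> {}"
      using that by auto
    moreover have "openin X (topspace X - A)" "openin X (topspace X - B)" using that by auto
    ultimately have "(topspace X - A) \<inter> (topspace X - B) \<inter> C \<noteq> {}"
      using R by blast
    with that show False by blast
  qed
  with R show "irreducible_closedin X C" unfolding irreducible_closedin_def by blast
qed

lemma irreducible_closedin_meets_Inter:
  assumes irr: "irreducible_closedin X C" and "finite I"
    and "\<And>i. i \<in> I \<Longrightarrow> openin X (U i) \<and> U i \<inter> C \<noteq> {}"
  shows "openin X (topspace X \<inter> (\<Inter>i\<in>I. U i)) \<and> topspace X \<inter> (\<Inter>i\<in>I. U i) \<inter> C \<noteq> {}"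
  using assms(2,3)
proof (induction I)
  case empty
  then show ?case
    using irr closedin_subset[of X C] by (auto simp: irreducible_closedin_def)
next
  case (insert i I)
  then have "openin X (U i \<inter> (topspace X \<inter> (\<Inter>i\<in>I. U i)))"
      "U i \<inter> (topspace X \<inter> (\<Inter>i\<in>I. U i)) \<inter> C \<noteq> {}"
    using irr unfolding irreducible_closedin_iff by auto
  then show ?case by (simp add: Int_ac)
qed

lemma irreducible_closedin_closure_of_point:
  assumes "x \<in> topspace X"
  shows "irreducible_closedin X (X closure_of {x})"
proof -
  have "x \<in> U" if "openin X U" "U \<inter> X closure_of {x} \<noteq> {}" for U
    using that by (auto simp: in_closure_of)
  moreover have "x \<in> X closure_of {x}" using assms by (auto simp: in_closure_of)
  ultimately show ?thesis
    unfolding irreducible_closedin_iff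
    using closedin_closure_of[of X "{x}"] by (metis IntI empty_iff)
qed

lemma sober_points_eqI:
  assumes "sober_space X" "x \<in> topspace X" "y \<in> topspace X"
    and same: "\<And>U. openin X U \<Longrightarrow> x \<in> U \<longleftrightarrow> y \<in> U"
  shows "x = y"
proof -
  have "X closure_of {x} = X closure_of {y}"
    using same by (auto simp: in_closure_of)
  then show ?thesis
    using assms irreducible_closedin_closure_of_point[of x X] unfolding sober_space_def by metis
qed

section \<open>Tight sets as minimal transversals\<close>

definition transversal :: "'a set \<Rightarrow> 'a entailment \<Rightarrow> 'a set \<Rightarrow> 'a set \<Rightarrow> bool" where
  "transversal S R H T \<longleftrightarrow> T \<subseteq> S \<and> (\<forall>G\<in>Fpow S. R H G \<longrightarrow> T \<inter> G \<noteq> {})"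

definition minimal_transversal :: "'a set \<Rightarrow> 'a entailment \<Rightarrow> 'a set \<Rightarrow> 'a set \<Rightarrow> bool" where
  "minimal_transversal S R H T \<longleftrightarrow>
     transversal S R H T \<and> (\<forall>T'. transversal S R H T' \<and> T' \<subseteq> T \<longrightarrow> T' = T)"

text \<open>
  Only finite sets \<open>G\<close> have to be met, so the intersection of a chain of transversals is
  a transversal. Zorn's lemma is applied to the complements within \<open>T\<^sub>0\<close>.
\<close>

lemma minimal_transversal_exists:
  assumes "transversal S R H T\<^sub>0"
  shows "\<exists>T\<subseteq>T\<^sub>0. minimal_transversal S R H T"
proof -
  define \<A> where "\<A> = {U. U \<subseteq> T\<^sub>0 \<and> transversal S R H (T\<^sub>0 - U)}"
  have "\<exists>M\<in>\<A>. \<forall>U\<in>\<A>. M \<subseteq> U \<longrightarrow> U = M"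
  proof (rule subset_Zorn_nonempty)
    show "\<A> \<noteq> {}" using assms unfolding \<A>_def by force
    fix \<C> assume "\<C> \<noteq> {}" and chain: "subset.chain \<A> \<C>"
    then have \<C>: "\<C> \<subseteq> \<A>" by (simp add: subset_chain_def)
    have "(T\<^sub>0 - \<Union>\<C>) \<inter> G \<noteq> {}" if "G \<in> Fpow S" "R H G" for G
    proof
      assume "(T\<^sub>0 - \<Union>\<C>) \<inter> G = {}"
      then have "T\<^sub>0 \<inter> G \<subseteq> \<Union>\<C>" by blast
      moreover have "finite (T\<^sub>0 \<inter> G)" using that by (auto simp: Fpow_def)
      ultimately obtain U where "U \<in> \<C>" "T\<^sub>0 \<inter> G \<subseteq> U"
        using finite_subset_Union_chain[OF _ _ \<open>\<C> \<noteq> {}\<close> chain] by blast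
      then have "(T\<^sub>0 - U) \<inter> G = {}" "transversal S R H (T\<^sub>0 - U)"
        using \<C> unfolding \<A>_def by auto
      with that show False unfolding transversal_def by blast
    qed
    with \<C> assms show "\<Union>\<C> \<in> \<A>"
      unfolding \<A>_def transversal_def by blast
  qed
  then obtain M where M: "M \<in> \<A>" "\<And>U. U \<in> \<A> \<Longrightarrow> M \<subseteq> U \<Longrightarrow> U = M" by blast
  have "T' = T\<^sub>0 - M" if "transversal S R H T'" "T' \<subseteq> T\<^sub>0 - M" for T'
  proof -
    have "T\<^sub>0 - (T\<^sub>0 - T') = T'" using that by blast
    then have "T\<^sub>0 - T' \<in> \<A>" using that unfolding \<A>_def by simp
    then have "T\<^sub>0 - T' = M" using M(2)[of "T\<^sub>0 - T'"] M(1) that unfolding \<A>_def by blast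
    with that show ?thesis by blast
  qed
  moreover have "transversal S R H (T\<^sub>0 - M)" using M(1) unfolding \<A>_def by blast
  ultimately show ?thesis unfolding minimal_transversal_def by blast
qed

lemma Fpow_UN: "finite I \<Longrightarrow> (\<And>i. i \<in> I \<Longrightarrow> A i \<in> Fpow S) \<Longrightarrow> (\<Union>i\<in>I. A i) \<in> Fpow S"
  by (simp add: Fpow_def UN_subset_iff)

lemma Fpow_Union: "\<A> \<in> Fpow (Fpow S) \<Longrightarrow> \<Union>\<A> \<in> Fpow S"
  by (auto simp: Fpow_def)

lemma Fpow_subset: "A \<in> Fpow S \<Longrightarrow> B \<subseteq> A \<Longrightarrow> B \<in> Fpow S"
  by (auto simp: Fpow_def intro: finite_subset)

lemma entails_mono:
  assumes "strong_idempotent S R" "R F G" "F \<subseteq> F'" "G \<subseteq> G'" "F' \<in> Fpow S" "G' \<in> Fpow S"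
  shows "R F' G'"
proof -
  have "F \<in> Fpow S" "G \<in> Fpow S"
    using Fpow_subset[OF assms(5,3)] Fpow_subset[OF assms(6,4)] .
  then show ?thesis
    using assms unfolding strong_idempotent_def monotone_ent_def by blast
qed

lemma entails_cut:
  assumes "strong_idempotent S R" "F \<in> Fpow S" "G \<in> Fpow S"
    and "\<F> \<in> Fpow (Fpow S)" "\<G> \<in> Fpow (Fpow S)" "cross S \<F> \<G>"
    and "\<And>F'. F' \<in> \<F> \<Longrightarrow> R F F'" "\<And>G'. G' \<in> \<G> \<Longrightarrow> R G' G"
  shows "R F G"
  using assms unfolding strong_idempotent_def cut_comp_def by blast

lemma entails_cut_singletons:
  assumes "strong_idempotent S R" "K \<in> Fpow S" "F \<in> Fpow S" "G \<in> Fpow S"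
    and "\<And>f. f \<in> F \<Longrightarrow> R K {f}" "R F G"
  shows "R K G"
proof (rule entails_cut[OF assms(1,2,4)])
  show "(\<lambda>f. {f}) ` F \<in> Fpow (Fpow S)" "{F} \<in> Fpow (Fpow S)"
    using assms(3) by (auto simp: Fpow_def)
  show "cross S ((\<lambda>f. {f}) ` F) {F}"
    by (auto simp: cross_def selectors_def)
qed (use assms in auto)

text \<open>
  This is where points are produced. For the forward half of tightness, let \<open>F \<subseteq> T\<close> with
  \<open>R F G\<close>. Each \<open>f \<in> F\<close> has a critical set \<open>C f\<close>, entailed by \<open>H\<close> and meeting \<open>T\<close> in \<open>f\<close> alone. A cut on
  interpolants of \<open>R H (C f)\<close> replaces each \<open>f\<close> by \<open>G\<close> and shows that \<open>H\<close> entails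
  \<open>(\<Union>f\<in>F. C f - {f}) \<union> G\<close>; since \<open>T\<close> avoids the first part, it meets \<open>G\<close>.
  The interpolants are indispensable, since \<open>R {g} {g}\<close> is not available for the side elements
  \<open>g \<in> C f - {f}\<close>. For the backward half, interpolating \<open>R H C\<close> for a critical set \<open>C\<close> of \<open>t\<close> gives
  a finite subset of \<open>T\<close> that entails a single element of \<open>C\<close>, which by the forward half lies in
  \<open>T\<close> and so is \<open>t\<close>.
\<close>

lemma minimal_transversal_tight:
  assumes strong: "strong_idempotent S R" and H: "H \<in> Fpow S" and min: "minimal_transversal S R H T"
  shows "tight S R T"
proof -
  have TS: "T \<subseteq> S" and T: "\<And>G. G \<in> Fpow S \<Longrightarrow> R H G \<Longrightarrow> T \<inter> G \<noteq> {}"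
    using min unfolding minimal_transversal_def transversal_def by auto
  have critical: "\<exists>G. G \<in> Fpow S \<and> R H G \<and> T \<inter> G = {t}" if "t \<in> T" for t
  proof -
    have "\<not> transversal S R H (T - {t})"
      using min that unfolding minimal_transversal_def by blast
    then obtain G where "G \<in> Fpow S" "R H G" "(T - {t}) \<inter> G = {}"
      using TS unfolding transversal_def by blast
    with T[of G] show ?thesis by blast
  qed
  have interpolant: "\<exists>\<F> \<G>. \<F> \<in> Fpow (Fpow S) \<and> \<G> \<in> Fpow (Fpow S) \<and> cross S \<F> \<G> \<and>
       (\<forall>F'\<in>\<F>. R H F') \<and> (\<forall>G'\<in>\<G>. \<exists>g\<in>G. R G' {g})" if "G \<in> Fpow S" "R H G" for G
  proof -
    have "cut_comp S R (single_ent R) H G"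
      using strong H that unfolding strong_idempotent_def by blast
    then show ?thesis unfolding cut_comp_def single_ent_def by blast
  qed
  have meets: "T \<inter> G \<noteq> {}" if F: "F \<in> Fpow T" and G: "G \<in> Fpow S" and FG: "R F G" for F G
  proof -
    have finF: "finite F" and FT: "F \<subseteq> T" using F by (auto simp: Fpow_def)
    obtain C where C: "\<And>f. f \<in> F \<Longrightarrow> C f \<in> Fpow S \<and> R H (C f) \<and> T \<inter> C f = {f}"
      using critical FT by (metis subsetD)
    have "\<forall>f\<in>F. \<exists>\<F> \<G>. \<F> \<in> Fpow (Fpow S) \<and> \<G> \<in> Fpow (Fpow S) \<and> cross S \<F> \<G> \<and>
       (\<forall>F'\<in>\<F>. R H F') \<and> (\<forall>G'\<in>\<G>. \<exists>g\<in>C f. R G' {g})"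
      using C interpolant by blast
    then obtain \<F> \<G> where \<F>\<G>: "\<And>f. f \<in> F \<Longrightarrow> \<F> f \<in> Fpow (Fpow S) \<and> \<G> f \<in> Fpow (Fpow S) \<and>
        cross S (\<F> f) (\<G> f) \<and> (\<forall>F'\<in>\<F> f. R H F') \<and> (\<forall>G'\<in>\<G> f. \<exists>g\<in>C f. R G' {g})"
      by metis
    define D where "D = (\<Union>f\<in>F. C f - {f}) \<union> G"
    have D: "D \<in> Fpow S"
      using C G finF unfolding D_def by (auto simp: Fpow_def)
    define \<K> where "\<K> = {K. K \<subseteq> (\<Union>f\<in>F. \<Union>(\<G> f)) \<and> R K D}"
    have W: "(\<Union>f\<in>F. \<Union>(\<G> f)) \<in> Fpow S"
      using \<F>\<G> finF by (intro Fpow_UN Fpow_Union) auto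
    have "R H D"
    proof (rule entails_cut[OF strong H D])
      show "(\<Union>f\<in>F. \<F> f) \<in> Fpow (Fpow S)"
        using \<F>\<G> finF by (intro Fpow_UN) auto
      have "\<K> \<subseteq> Pow (\<Union>f\<in>F. \<Union>(\<G> f))" by (auto simp: \<K>_def)
      moreover have "finite (Pow (\<Union>f\<in>F. \<Union>(\<G> f)))" using W by (simp add: Fpow_def)
      ultimately have "finite \<K>" by (rule finite_subset)
      moreover have "\<K> \<subseteq> Fpow S" using Fpow_subset[OF W] by (auto simp: \<K>_def)
      ultimately show "\<K> \<in> Fpow (Fpow S)" by (simp add: Fpow_def)
      show "cross S (\<Union>f\<in>F. \<F> f) \<K>"
        unfolding cross_def
      proof
        fix L assume L: "L \<in> selectors S (\<Union>f\<in>F. \<F> f)"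
        have "\<forall>f\<in>F. \<exists>G'. G' \<in> \<G> f \<and> G' \<subseteq> L"
        proof
          fix f assume "f \<in> F"
          then have "L \<in> selectors S (\<F> f)" using L by (auto simp: selectors_def)
          then show "\<exists>G'. G' \<in> \<G> f \<and> G' \<subseteq> L"
            using \<F>\<G>[OF \<open>f \<in> F\<close>] unfolding cross_def by blast
        qed
        then obtain E where E: "\<And>f. f \<in> F \<Longrightarrow> E f \<in> \<G> f \<and> E f \<subseteq> L" by metis
        \<comment> \<open>Either some interpolant below \<open>L\<close> entails a side element, which lies in \<open>D\<close>, or together
          they entail every element of \<open>F\<close>, hence \<open>G\<close>.\<close>
        show "\<exists>K\<in>\<K>. K \<subseteq> L"
        proof (cases "\<forall>f\<in>F. R (E f) {f}")
          case True
          let ?K = "\<Union>f\<in>F. E f"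
          have sub: "?K \<subseteq> (\<Union>f\<in>F. \<Union>(\<G> f))" using E by blast
          then have K: "?K \<in> Fpow S" using Fpow_subset[OF W] by blast
          have FS: "F \<in> Fpow S" using F TS by (auto simp: Fpow_def)
          have "R ?K {f}" if "f \<in> F" for f
          proof (rule entails_mono[OF strong _ _ order_refl K])
            show "R (E f) {f}" "E f \<subseteq> ?K" "{f} \<in> Fpow S"
              using True that FS by (auto simp: Fpow_def)
          qed
          then have "R ?K G"
            using entails_cut_singletons[OF strong K FS G] FG by blast
          then have "R ?K D"
            using entails_mono[OF strong _ order_refl _ K D] unfolding D_def by blast
          with sub have "?K \<in> \<K>" by (simp add: \<K>_def)
          moreover have "?K \<subseteq> L" using E by blast
          ultimately show ?thesis by (rule bexI[rotated])
        next
          case False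
          then obtain f where f: "f \<in> F" "\<not> R (E f) {f}" by blast
          then obtain g where "g \<in> C f" "R (E f) {g}" "g \<noteq> f" using \<F>\<G> E by metis
          then have "R (E f) {g}" "{g} \<subseteq> D" using f unfolding D_def by auto
          moreover have "E f \<in> Fpow S" using E[OF f(1)] \<F>\<G>[OF f(1)] by (auto simp: Fpow_def)
          ultimately have "R (E f) D" using entails_mono[OF strong] D by blast
          moreover have "E f \<subseteq> (\<Union>f\<in>F. \<Union>(\<G> f))" using E f by blast
          ultimately have "E f \<in> \<K>" by (simp add: \<K>_def)
          then show ?thesis using E f by blast
        qed
      qed
      show "R H F'" if "F' \<in> (\<Union>f\<in>F. \<F> f)" for F'
        using that \<F>\<G> by blast
      show "R K D" if "K \<in> \<K>" for K using that by (simp add: \<K>_def)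
    qed
    then have "T \<inter> D \<noteq> {}" using T D by blast
    moreover have "T \<inter> (C f - {f}) = {}" if "f \<in> F" for f using C[OF that] by blast
    ultimately show "T \<inter> G \<noteq> {}" unfolding D_def by blast
  qed
  have "\<exists>F\<in>Fpow T. R F G" if G: "G \<in> Fpow S" and "T \<inter> G \<noteq> {}" for G
  proof -
    obtain t where t: "t \<in> T" "t \<in> G" using \<open>T \<inter> G \<noteq> {}\<close> by blast
    then obtain C where C: "C \<in> Fpow S" "R H C" "T \<inter> C = {t}" using critical by blast
    then obtain \<F> \<G> where \<F>: "\<F> \<in> Fpow (Fpow S)" "\<G> \<in> Fpow (Fpow S)" "cross S \<F> \<G>"
        "\<forall>F'\<in>\<F>. R H F'" and \<G>: "\<forall>G'\<in>\<G>. \<exists>g\<in>C. R G' {g}"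
      using interpolant by blast
    have "T \<inter> \<Union>\<F> \<in> selectors S \<F>"
    proof -
      have "T \<inter> \<Union>\<F> \<inter> F' \<noteq> {}" if "F' \<in> \<F>" for F'
      proof -
        have "F' \<in> Fpow S" "R H F'" using \<F> that by (auto simp: Fpow_def)
        then have "T \<inter> F' \<noteq> {}" using T by blast
        with that show ?thesis by blast
      qed
      moreover have "finite (\<Union>\<F>)" using \<F>(1) by (auto simp: Fpow_def)
      ultimately show ?thesis using TS by (auto simp: selectors_def Fpow_def)
    qed
    then obtain G' where G': "G' \<in> \<G>" "G' \<subseteq> T \<inter> \<Union>\<F>"
      using \<F>(3) unfolding cross_def by blast
    then obtain g where g: "g \<in> C" "R G' {g}" using \<G> by blast
    have G'T: "G' \<in> Fpow T" "G' \<in> Fpow S" using G' \<F>(2) by (auto simp: Fpow_def)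
    have "{g} \<in> Fpow S" using g C by (auto simp: Fpow_def)
    then have "g \<in> T" using meets[OF G'T(1) _ g(2)] by blast
    then have "g = t" using g C by blast
    then have "R G' G"
      using entails_mono[OF strong g(2) order_refl _ G'T(2) G] t by blast
    then show ?thesis using G'T by blast
  qed
  with meets TS show ?thesis unfolding tight_def by blast
qed

text \<open>Boundedness of \<open>H\<close> serves to make the tight set non-empty.\<close>

lemma tight_point_below_transversal:
  assumes strong: "strong_idempotent S R" and H: "H \<in> bounded_sets S R"
    and "transversal S R H T\<^sub>0"
  shows "\<exists>T\<in>tight_points S R. T \<subseteq> T\<^sub>0 \<and> transversal S R H T"
proof -
  obtain T where T: "T \<subseteq> T\<^sub>0" "minimal_transversal S R H T"
    using assms minimal_transversal_exists by blast
  have "H \<in> Fpow S" using H by (simp add: bounded_sets_def)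
  then have "tight S R T" using minimal_transversal_tight strong T by blast
  moreover have "transversal S R H T" using T unfolding minimal_transversal_def by blast
  moreover from this H have "T \<noteq> {}" unfolding bounded_sets_def transversal_def by blast
  ultimately show ?thesis using T unfolding tight_points_def by blast
qed

section \<open>The tight spectrum\<close>

definition tight_box :: "'a set \<Rightarrow> 'a entailment \<Rightarrow> 'a set \<Rightarrow> 'a set set" where
  "tight_box S R F = {T \<in> tight_points S R. F \<subseteq> T}"

text \<open>
  A compact set wedged between \<^term>\<open>tight_box S R F\<close> and every union of
  subbasic sets entailed by \<open>F\<close>; it witnesses the relations \<^const>\<open>compactly_below\<close> in the spectrum.
\<close>

definition entailed_points :: "'a set \<Rightarrow> 'a entailment \<Rightarrow> 'a set \<Rightarrow> 'a set set" where
  "entailed_points S R F = {T \<in> tight_points S R. transversal S R F T}"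

lemma tight_box_eq: "tight_box S R F = topspace (tight_spectrum S R) \<inter> (\<Inter>f\<in>F. tight_nbhd S R f)"
  by (auto simp: tight_box_def topspace_tight_spectrum tight_nbhd_def)

lemma openin_tight_nbhd: "p \<in> S \<Longrightarrow> openin (tight_spectrum S R) (tight_nbhd S R p)"
  unfolding tight_spectrum_def by (simp add: topology_generated_by_Basis)

lemma openin_tight_box:
  assumes "F \<in> Fpow S"
  shows "openin (tight_spectrum S R) (tight_box S R F)"
proof -
  have "finite F" "F \<subseteq> S" using assms by (auto simp: Fpow_def)
  then show ?thesis
  proof (induction F)
    case empty
    then show ?case by (simp add: tight_box_eq)
  next
    case (insert f F)
    have "tight_box S R (insert f F) = tight_nbhd S R f \<inter> tight_box S R F"
      by (auto simp: tight_box_def tight_nbhd_def)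
    moreover have "openin (tight_spectrum S R) (tight_nbhd S R f)"
      using insert.prems by (intro openin_tight_nbhd) auto
    moreover have "openin (tight_spectrum S R) (tight_box S R F)"
      using insert.prems by (intro insert.IH) auto
    ultimately show ?case by (simp only: openin_Int)
  qed
qed

lemma tight_box_nbhd:
  assumes "openin (tight_spectrum S R) U" "T \<in> U"
  shows "\<exists>H\<in>Fpow S. H \<noteq> {} \<and> T \<in> tight_box S R H \<and> tight_box S R H \<subseteq> U"
proof -
  obtain \<H> where \<H>: "finite \<H>" "\<H> \<noteq> {}" "\<H> \<subseteq> tight_nbhd S R ` S" "T \<in> \<Inter>\<H>" "\<Inter>\<H> \<subseteq> U"
    using generated_topology_basic_nbhd[OF assms[unfolded tight_spectrum_def]] by blast
  obtain H where H: "H \<subseteq> S" "finite H" "\<H> = tight_nbhd S R ` H"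
    using finite_subset_image[OF \<H>(1,3)] by blast
  have "tight_box S R H = \<Inter>\<H>"
    using H(3) \<H>(2) by (auto simp: tight_box_def tight_nbhd_def)
  then have "T \<in> tight_box S R H" "tight_box S R H \<subseteq> U" using \<H>(4,5) by simp_all
  moreover have "H \<in> Fpow S" "H \<noteq> {}" using H \<H>(2) by (simp_all add: Fpow_def)
  ultimately show ?thesis by blast
qed

lemma tight_pointsD:
  assumes "T \<in> tight_points S R"
  shows "T \<noteq> {}" "T \<subseteq> S"
    "F \<in> Fpow T \<Longrightarrow> G \<in> Fpow S \<Longrightarrow> R F G \<Longrightarrow> T \<inter> G \<noteq> {}"
    "p \<in> T \<Longrightarrow> \<exists>F\<in>Fpow T. R F {p}"
proof -
  show "T \<noteq> {}" "T \<subseteq> S" using assms by (auto simp: tight_points_def tight_def)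
  show "T \<inter> G \<noteq> {}" if "F \<in> Fpow T" "G \<in> Fpow S" "R F G"
    using assms that unfolding tight_points_def tight_def by blast
  show "\<exists>F\<in>Fpow T. R F {p}" if "p \<in> T"
  proof -
    have "{p} \<in> Fpow S" "T \<inter> {p} \<noteq> {}" using that \<open>T \<subseteq> S\<close> by (auto simp: Fpow_def)
    then show ?thesis using assms unfolding tight_points_def tight_def by blast
  qed
qed

lemma tight_box_subset_entailed_points:
  assumes "F \<in> Fpow S"
  shows "tight_box S R F \<subseteq> entailed_points S R F"
proof
  fix T assume T: "T \<in> tight_box S R F"
  then have "T \<in> tight_points S R" "F \<in> Fpow T"
    using assms by (auto simp: tight_box_def Fpow_def)
  then show "T \<in> entailed_points S R F"
    unfolding entailed_points_def transversal_def using tight_pointsD by blast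
qed

lemma entailed_points_subset:
  assumes "G \<in> Fpow S" "R F G"
  shows "entailed_points S R F \<subseteq> (\<Union>g\<in>G. tight_nbhd S R g)"
  using assms unfolding entailed_points_def transversal_def tight_nbhd_def by blast

lemma entailed_points_subset_tight_box:
  assumes "\<And>h. h \<in> H \<Longrightarrow> R F {h}" "H \<in> Fpow S"
  shows "entailed_points S R F \<subseteq> tight_box S R H"
  using assms unfolding entailed_points_def transversal_def tight_box_def Fpow_def by blast

lemma entailed_points_antimono:
  assumes "strong_idempotent S R" "F \<subseteq> F'" "F' \<in> Fpow S"
  shows "entailed_points S R F' \<subseteq> entailed_points S R F"
  using entails_mono[OF assms(1) _ assms(2) order_refl assms(3)]
  unfolding entailed_points_def transversal_def by blast

text \<open>
  If \<open>(\<Union>p\<in>P. tight_nbhd S R p)\<close> contains all entailed points, no tight transversal avoids \<open>P\<close>, hence no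
  transversal at all does; so some finite \<open>G\<close> entailed by \<open>F\<close> is contained in \<open>P\<close>, and \<open>G\<close> gives the
  finite subcover.
\<close>

lemma compactin_entailed_points:
  assumes strong: "strong_idempotent S R" and F: "F \<in> bounded_sets S R"
  shows "compactin (tight_spectrum S R) (entailed_points S R F)"
  unfolding tight_spectrum_def
proof (rule compactin_generated_topology)
  show "entailed_points S R F \<subseteq> \<Union>(tight_nbhd S R ` S)"
    using tight_pointsD(1,2) by (fastforce simp: entailed_points_def tight_nbhd_def)
  fix \<C> assume \<C>: "\<C> \<subseteq> tight_nbhd S R ` S" "entailed_points S R F \<subseteq> \<Union>\<C>"
  define P where "P = {p \<in> S. tight_nbhd S R p \<in> \<C>}"
  have "\<not> transversal S R F (S - P)"
  proof
    assume "transversal S R F (S - P)"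
    then obtain T where T: "T \<in> tight_points S R" "T \<subseteq> S - P" "transversal S R F T"
      using tight_point_below_transversal[OF strong F] by blast
    then have "T \<in> \<Union>\<C>" using \<C>(2) by (auto simp: entailed_points_def)
    then obtain p where "p \<in> S" "tight_nbhd S R p \<in> \<C>" "T \<in> tight_nbhd S R p"
      using \<C>(1) by auto
    then have "p \<in> P" "p \<in> T" by (auto simp: P_def tight_nbhd_def)
    with T show False by blast
  qed
  then obtain G where G: "G \<in> Fpow S" "R F G" "(S - P) \<inter> G = {}"
    unfolding transversal_def by blast
  then have "G \<subseteq> P" by (auto simp: Fpow_def)
  show "\<exists>\<C>'. finite \<C>' \<and> \<C>' \<subseteq> \<C> \<and> entailed_points S R F \<subseteq> \<Union>\<C>'"
  proof (intro exI conjI)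
    show "finite (tight_nbhd S R ` G)" using G by (auto simp: Fpow_def)
    show "tight_nbhd S R ` G \<subseteq> \<C>" using \<open>G \<subseteq> P\<close> by (auto simp: P_def)
    show "entailed_points S R F \<subseteq> \<Union>(tight_nbhd S R ` G)"
      using entailed_points_subset G by blast
  qed
qed

lemma entails_imp_compactly_below:
  assumes "strong_idempotent S R" "F \<in> Fpow S" "G \<in> Fpow S" "R F G"
  shows "compactly_below (tight_spectrum S R) (tight_box S R F) (\<Union>g\<in>G. tight_nbhd S R g)"
proof (rule compactly_below_via_compact)
  show "compactin (tight_spectrum S R) (entailed_points S R F)"
    using assms by (intro compactin_entailed_points) (auto simp: bounded_sets_def)
  show "(\<Union>g\<in>G. tight_nbhd S R g) \<subseteq> topspace (tight_spectrum S R)"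
    by (auto simp: topspace_tight_spectrum tight_nbhd_def)
  show "tight_box S R F \<subseteq> entailed_points S R F"
    using assms(2) by (rule tight_box_subset_entailed_points)
  show "entailed_points S R F \<subseteq> (\<Union>g\<in>G. tight_nbhd S R g)"
    using assms(3,4) by (rule entailed_points_subset)
qed

text \<open>
  If \<open>R H {f}\<close> for all \<open>f \<in> F\<close> but not \<open>R H K\<close>, then by monotonicity \<open>S - K\<close> is a transversal for \<open>H\<close>. A
  tight transversal inside it contains \<open>F\<close> and misses \<open>K\<close>.
\<close>

lemma double_ent_if_tight_box_subset:
  assumes strong: "strong_idempotent S R" and F: "F \<in> Fpow S" and K: "K \<in> Fpow S"
    and sub: "tight_box S R F \<subseteq> (\<Union>k\<in>K. tight_nbhd S R k)"
  shows "double_ent S R F K"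
  unfolding double_ent_def
proof (intro ballI impI, rule ccontr)
  fix H assume H: "H \<in> bounded_sets S R" and HF: "\<forall>f\<in>F. R H {f}" and "\<not> R H K"
  have HS: "H \<in> Fpow S" using H by (simp add: bounded_sets_def)
  have "transversal S R H (S - K)"
    unfolding transversal_def
  proof (intro conjI ballI impI notI)
    fix G assume G: "G \<in> Fpow S" "R H G" "(S - K) \<inter> G = {}"
    then have "G \<subseteq> K" by (auto simp: Fpow_def)
    with G entails_mono[OF strong _ order_refl _ HS K] \<open>\<not> R H K\<close> show False by blast
  qed blast
  then obtain T where T: "T \<in> tight_points S R" "T \<subseteq> S - K" "transversal S R H T"
    using tight_point_below_transversal[OF strong H] by blast
  then have "T \<in> tight_box S R F"
    using entailed_points_subset_tight_box[of F R H S] HF F unfolding entailed_points_def by blast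
  with sub T show False unfolding tight_nbhd_def by blast
qed

lemma cover_relation_cut:
  assumes "cover_relation S R" "F \<in> Fpow S" "G \<in> Fpow S" "H \<in> Fpow S"
    and "double_ent S R F H" "\<And>h. h \<in> H \<Longrightarrow> R ({h} \<union> F) G"
  shows "R F G"
  using assms unfolding cover_relation_def by meson

text \<open>
  If \<open>F\<close> contains no \<open>H \<in> \<H>\<close>, then \<open>K = \<Union>\<H> - F\<close> meets each of them; the covering of \<^term>\<open>tight_box S R F\<close> then gives
  \<^term>\<open>double_ent S R F K\<close>. By the cover axiom it then suffices to treat the sets \<open>{k} \<union> F\<close> with \<open>k \<in> K\<close>, for which fewer elements
  of \<open>\<Union>\<H>\<close> are left over. Once \<open>F\<close> contains some \<open>H \<in> \<H>\<close>, monotonicity finishes.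
\<close>

lemma entails_if_covered_by_tight_boxes:
  assumes cov: "cover_relation S R" and F: "F \<in> Fpow S" and G: "G \<in> Fpow S"
    and \<H>: "\<H> \<in> Fpow (Fpow S)" "\<And>H. H \<in> \<H> \<Longrightarrow> R H G"
    and sub: "tight_box S R F \<subseteq> (\<Union>H\<in>\<H>. tight_box S R H)"
  shows "R F G"
  using F sub
proof (induction "card (\<Union>\<H> - F)" arbitrary: F rule: less_induct)
  case less
  have strong: "strong_idempotent S R" using cov by (simp add: cover_relation_def)
  have fin: "\<Union>\<H> \<in> Fpow S" using \<H>(1) by (auto simp: Fpow_def)
  show ?case
  proof (cases "\<exists>H\<in>\<H>. H \<subseteq> F")
    case True
    then show ?thesis
      using entails_mono[OF strong _ _ order_refl] \<H>(2) less.prems(1) G by blast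
  next
    case False
    define K where "K = \<Union>\<H> - F"
    have K: "K \<in> Fpow S" using fin by (auto simp: K_def Fpow_def)
    have "tight_box S R F \<subseteq> (\<Union>k\<in>K. tight_nbhd S R k)"
    proof
      fix T assume T: "T \<in> tight_box S R F"
      then obtain H where "H \<in> \<H>" "T \<in> tight_box S R H" using less.prems(2) by blast
      moreover from this False obtain k where "k \<in> H" "k \<notin> F" by blast
      ultimately have "k \<in> K" "T \<in> tight_nbhd S R k"
        by (auto simp: K_def tight_box_def tight_nbhd_def)
      then show "T \<in> (\<Union>k\<in>K. tight_nbhd S R k)" by blast
    qed
    then have "double_ent S R F K"
      using double_ent_if_tight_box_subset[OF strong less.prems(1) K] by blast
    moreover have "R ({k} \<union> F) G" if "k \<in> K" for k
    proof (rule less.hyps)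
      have "\<Union>\<H> - ({k} \<union> F) \<subset> \<Union>\<H> - F" using that by (auto simp: K_def)
      moreover have "finite (\<Union>\<H> - F)" using fin by (auto simp: Fpow_def)
      ultimately show "card (\<Union>\<H> - ({k} \<union> F)) < card (\<Union>\<H> - F)"
        by (rule psubset_card_mono[rotated])
      show "{k} \<union> F \<in> Fpow S" using that K less.prems(1) by (auto simp: Fpow_def)
      show "tight_box S R ({k} \<union> F) \<subseteq> (\<Union>H\<in>\<H>. tight_box S R H)"
        using less.prems(2) by (rule order_trans[rotated]) (auto simp: tight_box_def)
    qed
    ultimately show ?thesis
      by (rule cover_relation_cut[OF cov less.prems(1) G K])
  qed
qed

text \<open>
  For the converse direction, \<open>\<Union>g\<in>G. tight_nbhd S R g\<close> is covered by the boxes of all \<open>H\<close> with \<open>R H G\<close>,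
  because an element of a tight set is entailed by a finite subset of it.
\<close>

lemma entails_iff_compactly_below:
  assumes cov: "cover_relation S R" and F: "F \<in> Fpow S" and G: "G \<in> Fpow S"
  shows "R F G \<longleftrightarrow>
    compactly_below (tight_spectrum S R) (tight_box S R F) (\<Union>g\<in>G. tight_nbhd S R g)"
    (is "_ \<longleftrightarrow> ?below")
proof
  have strong: "strong_idempotent S R" using cov by (simp add: cover_relation_def)
  show "R F G \<Longrightarrow> ?below" using entails_imp_compactly_below[OF strong F G] .
  assume below: ?below
  define \<H> where "\<H> = {H \<in> Fpow S. R H G}"
  have "(\<Union>g\<in>G. tight_nbhd S R g) \<subseteq> \<Union>(tight_box S R ` \<H>)"
  proof
    fix T assume "T \<in> (\<Union>g\<in>G. tight_nbhd S R g)"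
    then obtain g where g: "g \<in> G" "g \<in> T" and T: "T \<in> tight_points S R"
      by (auto simp: tight_nbhd_def)
    obtain H where H: "H \<in> Fpow T" "R H {g}" using tight_pointsD(4)[OF T g(2)] by blast
    then have HS: "H \<in> Fpow S" using tight_pointsD(2)[OF T] by (auto simp: Fpow_def)
    have "R H G" using entails_mono[OF strong H(2) order_refl _ HS G] g by blast
    then have "H \<in> \<H>" using HS by (simp add: \<H>_def)
    moreover have "T \<in> tight_box S R H" using H T by (auto simp: tight_box_def Fpow_def)
    ultimately show "T \<in> \<Union>(tight_box S R ` \<H>)" by blast
  qed
  moreover have "\<forall>U\<in>tight_box S R ` \<H>. openin (tight_spectrum S R) U"
    using openin_tight_box by (auto simp: \<H>_def)
  ultimately obtain \<V> where "\<V> \<subseteq> tight_box S R ` \<H>" "finite \<V>" "tight_box S R F \<subseteq> \<Union>\<V>"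
    using below unfolding compactly_below_def by meson
  then obtain \<K> where \<K>: "\<K> \<subseteq> \<H>" "finite \<K>" "tight_box S R F \<subseteq> \<Union>(tight_box S R ` \<K>)"
    by (metis finite_subset_image)
  show "R F G"
    by (rule entails_if_covered_by_tight_boxes[OF cov F G, of \<K>])
      (use \<K> in \<open>auto simp: \<H>_def Fpow_def\<close>)
qed

text \<open>
  Any box around \<open>T\<close> inside \<open>U\<close> is given by a finite \<open>H \<subseteq> T\<close>, and tightness supplies a finite
  \<open>F \<subseteq> T\<close> that entails each element of \<open>H\<close>. Choosing \<open>H\<close> non-empty makes \<open>F\<close> bounded.
\<close>

lemma tight_spectrum_core_nbhd:
  assumes strong: "strong_idempotent S R"
    and U: "openin (tight_spectrum S R) U" and T: "T \<in> U"
  shows "\<exists>F\<in>bounded_sets S R. T \<in> tight_box S R F \<and> entailed_points S R F \<subseteq> U"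
proof -
  obtain H where H: "H \<in> Fpow S" "H \<noteq> {}" "T \<in> tight_box S R H" "tight_box S R H \<subseteq> U"
    using tight_box_nbhd[OF U T] by blast
  then have HT: "H \<subseteq> T" and TP: "T \<in> tight_points S R" by (auto simp: tight_box_def)
  then obtain E where E: "\<And>h. h \<in> H \<Longrightarrow> E h \<in> Fpow T \<and> R (E h) {h}"
    using tight_pointsD(4)[OF TP] by (metis subsetD)
  define F where "F = (\<Union>h\<in>H. E h)"
  have FT: "F \<in> Fpow T" using E H(1) by (auto simp: F_def Fpow_def)
  then have FS: "F \<in> Fpow S" using tight_pointsD(2)[OF TP] by (auto simp: Fpow_def)
  have FH: "R F {h}" if "h \<in> H" for h
  proof (rule entails_mono[OF strong _ _ order_refl FS])
    show "R (E h) {h}" "E h \<subseteq> F" "{h} \<in> Fpow S" using E that H by (auto simp: F_def Fpow_def)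
  qed
  have "F \<in> bounded_sets S R"
  proof -
    obtain h where "h \<in> H" using H by blast
    then have "{h} \<in> Fpow S" "R F {h}" using FH H by (auto simp: Fpow_def)
    then show ?thesis using FS unfolding bounded_sets_def by blast
  qed
  moreover have "T \<in> tight_box S R F" using FT TP by (auto simp: tight_box_def Fpow_def)
  moreover have "entailed_points S R F \<subseteq> U"
    using entailed_points_subset_tight_box[of H R F S] FH H by blast
  ultimately show ?thesis by blast
qed

lemma core_compact_tight_spectrum:
  assumes strong: "strong_idempotent S R"
  shows "core_compact_space (tight_spectrum S R)"
  unfolding core_compact_space_def
proof (intro allI impI, elim conjE)
  fix U T assume U: "openin (tight_spectrum S R) U" and T: "T \<in> U"
  obtain F where F: "F \<in> bounded_sets S R" "T \<in> tight_box S R F" "entailed_points S R F \<subseteq> U"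
    using tight_spectrum_core_nbhd[OF strong U T] by blast
  then have FS: "F \<in> Fpow S" by (simp add: bounded_sets_def)
  have "compactly_below (tight_spectrum S R) (tight_box S R F) U"
    using compactly_below_via_compact compactin_entailed_points[OF strong F(1)]
      tight_box_subset_entailed_points[OF FS] F(3) openin_subset[OF U] by blast
  then show "\<exists>V. openin (tight_spectrum S R) V \<and> T \<in> V \<and> compactly_below (tight_spectrum S R) V U"
    using openin_tight_box[OF FS] F(2) by blast
qed

text \<open>
  The strict form of a finite subcover: the boxes stay inside compact subsets of \<open>U\<close>. Two such
  covers, for \<open>U\<close> and \<open>V\<close>, can be intersected box by box, since \<^const>\<open>entailed_points\<close> is
  antitone; this is how core coherence follows.
\<close>

lemma compactly_below_covered_by_core_boxes:
  assumes strong: "strong_idempotent S R" and U: "openin (tight_spectrum S R) U"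
    and below: "compactly_below (tight_spectrum S R) P U"
  shows "\<exists>\<F>\<subseteq>bounded_sets S R. finite \<F> \<and> P \<subseteq> (\<Union>F\<in>\<F>. tight_box S R F) \<and>
           (\<forall>F\<in>\<F>. entailed_points S R F \<subseteq> U)"
proof -
  define \<B> where "\<B> = {F \<in> bounded_sets S R. entailed_points S R F \<subseteq> U}"
  have "U \<subseteq> \<Union>(tight_box S R ` \<B>)"
    using tight_spectrum_core_nbhd[OF strong U] unfolding \<B>_def by blast
  moreover have "\<forall>V\<in>tight_box S R ` \<B>. openin (tight_spectrum S R) V"
    using openin_tight_box by (auto simp: \<B>_def bounded_sets_def)
  ultimately obtain \<V> where "\<V> \<subseteq> tight_box S R ` \<B>" "finite \<V>" "P \<subseteq> \<Union>\<V>"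
    using below unfolding compactly_below_def by meson
  then obtain \<F> where "\<F> \<subseteq> \<B>" "finite \<F>" "P \<subseteq> \<Union>(tight_box S R ` \<F>)"
    by (metis finite_subset_image)
  then show ?thesis unfolding \<B>_def by blast
qed

lemma core_coherent_tight_spectrum:
  assumes strong: "strong_idempotent S R"
  shows "core_coherent_space (tight_spectrum S R)"
  unfolding core_coherent_space_def
proof (intro allI impI, elim conjE)
  fix P U V assume U: "openin (tight_spectrum S R) U" and V: "openin (tight_spectrum S R) V"
    and PU: "compactly_below (tight_spectrum S R) P U" and PV: "compactly_below (tight_spectrum S R) P V"
  obtain \<F> where \<F>: "\<F> \<subseteq> bounded_sets S R" "finite \<F>" "P \<subseteq> (\<Union>F\<in>\<F>. tight_box S R F)"
      "\<And>F. F \<in> \<F> \<Longrightarrow> entailed_points S R F \<subseteq> U"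
    using compactly_below_covered_by_core_boxes[OF strong U PU] by metis
  obtain \<G> where \<G>: "\<G> \<subseteq> bounded_sets S R" "finite \<G>" "P \<subseteq> (\<Union>G\<in>\<G>. tight_box S R G)"
      "\<And>G. G \<in> \<G> \<Longrightarrow> entailed_points S R G \<subseteq> V"
    using compactly_below_covered_by_core_boxes[OF strong V PV] by metis
  have top: "U \<inter> V \<subseteq> topspace (tight_spectrum S R)" using openin_subset[OF U] by blast
  have "compactly_below (tight_spectrum S R)
      (\<Union>(F, G)\<in>\<F>\<times>\<G>. tight_box S R (F \<union> G)) (U \<inter> V)"
  proof (rule compactly_below_UN)
    fix i assume "i \<in> \<F> \<times> \<G>"
    then obtain F G where i: "i = (F, G)" and FG: "F \<in> \<F>" "G \<in> \<G>" by blast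
    obtain D where D: "F \<in> Fpow S" "G \<in> Fpow S" "D \<in> Fpow S" "R F D"
      using FG \<F>(1) \<G>(1) by (auto simp: bounded_sets_def)
    then have FGS: "F \<union> G \<in> Fpow S" by (auto simp: Fpow_def)
    then have "R (F \<union> G) D" using entails_mono[OF strong D(4)] D by blast
    then have "F \<union> G \<in> bounded_sets S R" using FGS D by (auto simp: bounded_sets_def)
    then have "compactin (tight_spectrum S R) (entailed_points S R (F \<union> G))"
      by (rule compactin_entailed_points[OF strong])
    moreover have "entailed_points S R (F \<union> G) \<subseteq> U \<inter> V"
      using entailed_points_antimono[OF strong _ FGS] \<F>(4) \<G>(4) FG by blast
    ultimately have "compactly_below (tight_spectrum S R) (tight_box S R (F \<union> G)) (U \<inter> V)"
      by (rule compactly_below_via_compact[OF _ tight_box_subset_entailed_points[OF FGS] _ top])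
    then show "compactly_below (tight_spectrum S R)
        (case i of (F, G) \<Rightarrow> tight_box S R (F \<union> G)) (U \<inter> V)"
      by (simp add: i)
  qed (use \<F> \<G> top in auto)
  moreover have "P \<subseteq> (\<Union>(F, G)\<in>\<F>\<times>\<G>. tight_box S R (F \<union> G))"
  proof
    fix T assume "T \<in> P"
    then obtain F G where "F \<in> \<F>" "G \<in> \<G>" "T \<in> tight_box S R F" "T \<in> tight_box S R G"
      using \<F>(3) \<G>(3) by blast
    then show "T \<in> (\<Union>(F, G)\<in>\<F>\<times>\<G>. tight_box S R (F \<union> G))"
      by (auto simp: tight_box_def intro!: bexI[of _ "(F, G)"])
  qed
  ultimately show "compactly_below (tight_spectrum S R) P (U \<inter> V)"
    using compactly_below_mono top by blast
qed

text \<open>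
  The generic point of an irreducible closed set \<open>C\<close> is the union of its members: irreducibility makes
  every finite subset of \<open>\<Union>C\<close> a subset of a single member of \<open>C\<close>, so tightness passes to the union.
\<close>

lemma sober_tight_spectrum: "sober_space (tight_spectrum S R)"
  unfolding sober_space_def
proof (intro allI impI)
  fix C assume irr: "irreducible_closedin (tight_spectrum S R) C"
  then have clo: "closedin (tight_spectrum S R) C" and "C \<noteq> {}"
    by (auto simp: irreducible_closedin_def)
  then have CP: "C \<subseteq> tight_points S R"
    using closedin_subset topspace_tight_spectrum by metis
  define T where "T = \<Union>C"
  have TS: "T \<subseteq> S" using CP tight_pointsD(2) by (fastforce simp: T_def)
  have box: "\<exists>T'\<in>C. F \<subseteq> T'" if "F \<in> Fpow T" for F
  proof -
    have "openin (tight_spectrum S R) (tight_nbhd S R f) \<and> tight_nbhd S R f \<inter> C \<noteq> {}"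
      if "f \<in> F" for f
    proof
      have "f \<in> T" using that \<open>F \<in> Fpow T\<close> by (auto simp: Fpow_def)
      then show "openin (tight_spectrum S R) (tight_nbhd S R f)"
        using TS by (intro openin_tight_nbhd) auto
      show "tight_nbhd S R f \<inter> C \<noteq> {}" using \<open>f \<in> T\<close> CP by (auto simp: tight_nbhd_def T_def)
    qed
    moreover have "finite F" using that by (auto simp: Fpow_def)
    ultimately have "topspace (tight_spectrum S R) \<inter> (\<Inter>f\<in>F. tight_nbhd S R f) \<inter> C \<noteq> {}"
      using irreducible_closedin_meets_Inter[OF irr] by blast
    then obtain T' where "T' \<in> C" "\<And>f. f \<in> F \<Longrightarrow> T' \<in> tight_nbhd S R f" by blast
    then show ?thesis by (auto simp: tight_nbhd_def)
  qed
  have "T \<in> tight_points S R"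
  proof -
    have "T \<inter> G \<noteq> {}" if F: "F \<in> Fpow T" and "G \<in> Fpow S" "R F G" for F G
    proof -
      obtain T' where T': "T' \<in> C" "F \<subseteq> T'" using box[OF F] by blast
      then have "F \<in> Fpow T'" using F by (auto simp: Fpow_def)
      moreover have "T' \<in> tight_points S R" using T' CP by blast
      ultimately have "T' \<inter> G \<noteq> {}" using tight_pointsD(3) that by metis
      then show ?thesis using T' by (auto simp: T_def)
    qed
    moreover have "\<exists>F\<in>Fpow T. R F G" if G: "G \<in> Fpow S" and meet: "T \<inter> G \<noteq> {}" for G
    proof -
      obtain T' where T': "T' \<in> C" "T' \<inter> G \<noteq> {}" using meet by (auto simp: T_def)
      then have "tight S R T'" using CP by (auto simp: tight_points_def)
      then obtain F where "F \<in> Fpow T'" "R F G"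
        using T'(2) G unfolding tight_def by blast
      then show ?thesis using T' by (auto simp: T_def Fpow_def)
    qed
    moreover have "T \<noteq> {}" using \<open>C \<noteq> {}\<close> CP tight_pointsD(1) by (fastforce simp: T_def)
    ultimately show ?thesis using TS unfolding tight_points_def tight_def by blast
  qed
  then have Ttop: "T \<in> topspace (tight_spectrum S R)" by (simp add: topspace_tight_spectrum)
  have "T \<in> C"
  proof (rule ccontr)
    assume "T \<notin> C"
    moreover have "openin (tight_spectrum S R) (topspace (tight_spectrum S R) - C)"
      using clo by blast
    ultimately obtain H where H: "T \<in> tight_box S R H" "H \<in> Fpow S"
        "tight_box S R H \<subseteq> topspace (tight_spectrum S R) - C"
      using tight_box_nbhd Ttop by (metis DiffI)
    then have "H \<in> Fpow T" by (auto simp: tight_box_def Fpow_def)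
    then obtain T' where "T' \<in> C" "H \<subseteq> T'" using box by blast
    then show False using H CP by (auto simp: tight_box_def)
  qed
  have "C = tight_spectrum S R closure_of {T}"
  proof
    show "tight_spectrum S R closure_of {T} \<subseteq> C"
      using \<open>T \<in> C\<close> clo by (simp add: closure_of_minimal)
    show "C \<subseteq> tight_spectrum S R closure_of {T}"
    proof
      fix T' assume "T' \<in> C"
      have "T \<in> U" if "openin (tight_spectrum S R) U" "T' \<in> U" for U
      proof -
        obtain H where "T' \<in> tight_box S R H" "tight_box S R H \<subseteq> U"
          using tight_box_nbhd \<open>openin (tight_spectrum S R) U\<close> \<open>T' \<in> U\<close> by metis
        moreover from this have "T \<in> tight_box S R H"
          using \<open>T' \<in> C\<close> \<open>T \<in> tight_points S R\<close> by (auto simp: tight_box_def T_def)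
        ultimately show ?thesis by blast
      qed
      then show "T' \<in> tight_spectrum S R closure_of {T}"
        using \<open>T' \<in> C\<close> CP by (auto simp: in_closure_of topspace_tight_spectrum)
    qed
  qed
  moreover have "T' = T" if T': "T' \<in> topspace (tight_spectrum S R)"
    "C = tight_spectrum S R closure_of {T'}" for T'
  proof
    have "T' \<in> C" using T' by (auto simp: in_closure_of)
    then show "T' \<subseteq> T" by (auto simp: T_def)
    show "T \<subseteq> T'"
    proof
      fix p assume "p \<in> T"
      then have "openin (tight_spectrum S R) (tight_nbhd S R p)"
        using TS by (intro openin_tight_nbhd) auto
      moreover have "T \<in> tight_nbhd S R p"
        using \<open>p \<in> T\<close> \<open>T \<in> tight_points S R\<close> by (simp add: tight_nbhd_def)
      ultimately have "T' \<in> tight_nbhd S R p"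
        using \<open>T \<in> C\<close> T'(2) by (auto simp: in_closure_of)
      then show "p \<in> T'" by (simp add: tight_nbhd_def)
    qed
  qed
  ultimately show "\<exists>!x. x \<in> topspace (tight_spectrum S R) \<and> C = tight_spectrum S R closure_of {x}"
    using Ttop by blast
qed

lemma inj_on_tight_nbhd:
  assumes "antisymmetric_cover_system S R"
  shows "inj_on (tight_nbhd S R) S"
proof (rule inj_onI)
  fix p q assume pq: "p \<in> S" "q \<in> S" "tight_nbhd S R p = tight_nbhd S R q"
  have strong: "strong_idempotent S R"
    using assms by (simp add: antisymmetric_cover_system_def cover_relation_def)
  have "tight_box S R {r} = tight_nbhd S R r" for r
    by (auto simp: tight_box_def tight_nbhd_def)
  moreover have "{p} \<in> Fpow S" "{q} \<in> Fpow S" using pq by (auto simp: Fpow_def)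
  ultimately have "double_ent S R {p} {q}" "double_ent S R {q} {p}"
    using pq by (auto intro!: double_ent_if_tight_box_subset[OF strong])
  then show "p = q"
    using assms pq unfolding antisymmetric_cover_system_def by blast
qed

lemma subbasis_of_tight_spectrum: "subbasis_of (tight_spectrum S R) (tight_nbhd S R ` S)"
proof -
  have "\<Union>(tight_nbhd S R ` S) = topspace (tight_spectrum S R)"
    by (simp add: tight_spectrum_def)
  then show ?thesis
    using openin_tight_nbhd by (auto simp: subbasis_of_def tight_spectrum_def)
qed

section \<open>Compact covers on a subbasis\<close>

lemma subbasis_openin: "subbasis_of X S \<Longrightarrow> p \<in> S \<Longrightarrow> openin X p"
  by (simp add: subbasis_of_def)

lemma subbasis_openin_Union: "subbasis_of X S \<Longrightarrow> G \<subseteq> S \<Longrightarrow> openin X (\<Union>G)"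
  by (meson openin_Union subbasis_openin subsetD)

lemma subbasis_openin_Inter:
  assumes "subbasis_of X S" "F \<in> Fpow S"
  shows "openin X (topspace X \<inter> \<Inter>F)"
  using assms by (cases "F = {}") (auto simp: Fpow_def subbasis_openin intro!: openin_Int openin_Inter)

lemma subbasis_basic_nbhd:
  assumes sub: "subbasis_of X S" and U: "openin X U" "x \<in> U"
  shows "\<exists>H\<in>Fpow S. H \<noteq> {} \<and> x \<in> \<Inter>H \<and> \<Inter>H \<subseteq> U"
proof -
  have "openin (topology_generated_by S) U" using sub U(1) by (simp add: subbasis_of_def)
  from generated_topology_basic_nbhd[OF this U(2)] obtain H
    where "finite H" "H \<noteq> {}" "H \<subseteq> S" "x \<in> \<Inter>H" "\<Inter>H \<subseteq> U" by metis
  moreover from this have "H \<in> Fpow S" by (simp add: Fpow_def)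
  ultimately show ?thesis by blast
qed

lemma subbasis_core_nbhd:
  assumes core: "core_compact_space X" and sub: "subbasis_of X S" and U: "openin X U" "x \<in> U"
  shows "\<exists>H\<in>Fpow S. x \<in> \<Inter>H \<and> compactly_below X (topspace X \<inter> \<Inter>H) U"
proof -
  obtain V where V: "openin X V" "x \<in> V" "compactly_below X V U"
    using core U unfolding core_compact_space_def by meson
  obtain H where H: "H \<in> Fpow S" "x \<in> \<Inter>H" "\<Inter>H \<subseteq> V"
    using subbasis_basic_nbhd[OF sub V(1,2)] by blast
  have "compactly_below X (topspace X \<inter> \<Inter>H) U"
    by (rule compactly_below_mono[OF V(3) _ order_refl openin_subset[OF U(1)]]) (use H in blast)
  with H show ?thesis by blast
qed

text \<open>
  Every open set \<open>W\<close> is the union of the finite intersections of subbasic sets that are compactly below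
  \<open>W\<close>, so \<open>core_compact_finite_subfamily\<close> selects finitely many of these.
\<close>

lemma subbasis_interpolation:
  assumes core: "core_compact_space X" and sub: "subbasis_of X S"
    and op: "\<And>W. W \<in> \<W> \<Longrightarrow> openin X W" and below: "compactly_below X p (\<Union>\<W>)"
  shows "\<exists>\<H>\<in>Fpow (Fpow S). (\<forall>H\<in>\<H>. \<exists>W\<in>\<W>. compactly_below X (topspace X \<inter> \<Inter>H) W) \<and>
           compactly_below X p (\<Union>H\<in>\<H>. topspace X \<inter> \<Inter>H)"
proof -
  define \<B> where "\<B> = {H \<in> Fpow S. \<exists>W\<in>\<W>. compactly_below X (topspace X \<inter> \<Inter>H) W}"
  define m where "m = (\<lambda>H. topspace X \<inter> \<Inter>H)"
  have op_m: "openin X U" if "U \<in> m ` \<B>" for U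
    using that subbasis_openin_Inter[OF sub] by (auto simp: \<B>_def m_def)
  have "\<Union>\<W> \<subseteq> \<Union>(m ` \<B>)"
  proof
    fix x assume "x \<in> \<Union>\<W>"
    then obtain W where W: "W \<in> \<W>" "x \<in> W" by blast
    then obtain H where "H \<in> Fpow S" "x \<in> \<Inter>H" "compactly_below X (topspace X \<inter> \<Inter>H) W"
      using subbasis_core_nbhd[OF core sub op] by blast
    moreover have "x \<in> topspace X" using op[OF W(1)] W(2) openin_subset by blast
    ultimately have "H \<in> \<B>" "x \<in> m H" using W by (auto simp: \<B>_def m_def)
    then show "x \<in> \<Union>(m ` \<B>)" by blast
  qed
  moreover have "\<Union>(m ` \<B>) \<subseteq> topspace X" by (auto simp: m_def)
  ultimately have "compactly_below X p (\<Union>(m ` \<B>))"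
    by (rule compactly_below_mono[OF below order_refl])
  then obtain \<V> where \<V>: "\<V> \<subseteq> m ` \<B>" "finite \<V>" "compactly_below X p (\<Union>\<V>)"
    using core_compact_finite_subfamily[OF core op_m] by blast
  obtain \<H> where \<H>: "\<H> \<subseteq> \<B>" "finite \<H>" "\<V> = m ` \<H>"
    using finite_subset_image[OF \<V>(2,1)] by blast
  have "\<H> \<in> Fpow (Fpow S)" using \<H> by (auto simp: Fpow_def \<B>_def)
  moreover have "\<forall>H\<in>\<H>. \<exists>W\<in>\<W>. compactly_below X (topspace X \<inter> \<Inter>H) W"
    using \<H>(1) by (auto simp: \<B>_def)
  moreover have "compactly_below X p (\<Union>H\<in>\<H>. topspace X \<inter> \<Inter>H)"
    using \<V>(3) \<H>(3) by (simp add: m_def)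
  ultimately show ?thesis by blast
qed

lemma compact_cover_mono:
  assumes sub: "subbasis_of X S" and "compact_cover X F G" "F \<subseteq> F'" "G \<subseteq> G'" "G' \<subseteq> S"
  shows "compact_cover X F' G'"
  using assms(2) unfolding compact_cover_def
proof (rule compactly_below_mono)
  show "topspace X \<inter> \<Inter>F' \<subseteq> topspace X \<inter> \<Inter>F" using assms(3) by blast
  show "\<Union>G \<subseteq> \<Union>G'" using assms(4) by (rule Union_mono)
  show "\<Union>G' \<subseteq> topspace X" by (rule openin_subset[OF subbasis_openin_Union[OF sub assms(5)]])
qed

lemma compact_cover_imp_subset:
  assumes "subbasis_of X S" "compact_cover X F G" "G \<subseteq> S"
  shows "topspace X \<inter> \<Inter>F \<subseteq> \<Union>G"
  using compactly_below_imp_subset[OF assms(2)[unfolded compact_cover_def]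
      subbasis_openin_Union[OF assms(1,3)]] .

lemma compact_cover_UN:
  assumes sub: "subbasis_of X S" and "finite I" "G \<subseteq> S"
    and "topspace X \<inter> \<Inter>F \<subseteq> (\<Union>i\<in>I. topspace X \<inter> \<Inter>(K i))"
    and "\<And>i. i \<in> I \<Longrightarrow> compact_cover X (K i) G"
  shows "compact_cover X F G"
proof -
  have top: "\<Union>G \<subseteq> topspace X" using openin_subset[OF subbasis_openin_Union[OF sub assms(3)]] .
  have "compactly_below X (\<Union>i\<in>I. topspace X \<inter> \<Inter>(K i)) (\<Union>G)"
    using assms(5) by (intro compactly_below_UN[OF assms(2) top]) (simp add: compact_cover_def)
  then show ?thesis
    unfolding compact_cover_def by (rule compactly_below_mono[OF _ assms(4) order_refl top])
qed

text \<open>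
  Crossing families express distributivity: for a point \<open>x\<close> of \<open>\<Inter>F\<close>, the members of \<open>\<Union>\<F>\<close> that
  contain \<open>x\<close> form a selector, so \<open>x\<close> lies in \<open>\<Inter>G'\<close> for some \<open>G' \<in> \<G>\<close>. Thus \<open>\<Inter>F\<close> is covered by
  finitely many sets compactly below \<open>\<Union>G\<close>.
\<close>

lemma compact_cover_cut:
  assumes sub: "subbasis_of X S" and G: "G \<in> Fpow S"
    and cut: "cut_comp S (compact_cover X) (compact_cover X) F G"
  shows "compact_cover X F G"
proof -
  obtain \<F> \<G> where \<F>: "\<F> \<in> Fpow (Fpow S)" and \<G>: "\<G> \<in> Fpow (Fpow S)" and cross: "cross S \<F> \<G>"
    and F: "\<And>F'. F' \<in> \<F> \<Longrightarrow> compact_cover X F F'" and G': "\<And>G'. G' \<in> \<G> \<Longrightarrow> compact_cover X G' G"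
    using cut unfolding cut_comp_def by blast
  show ?thesis
  proof (rule compact_cover_UN[OF sub, where I = \<G> and K = "\<lambda>G'. G'"])
    show "topspace X \<inter> \<Inter>F \<subseteq> (\<Union>G'\<in>\<G>. topspace X \<inter> \<Inter>G')"
    proof
      fix x assume x: "x \<in> topspace X \<inter> \<Inter>F"
      have "{p \<in> \<Union>\<F>. x \<in> p} \<in> selectors S \<F>"
      proof -
        have "\<exists>p\<in>F'. x \<in> p" if "F' \<in> \<F>" for F'
        proof -
          have "F' \<subseteq> S" using \<F> that by (auto simp: Fpow_def)
          then show ?thesis using compact_cover_imp_subset[OF sub F[OF that]] x by blast
        qed
        moreover have "{p \<in> \<Union>\<F>. x \<in> p} \<in> Fpow S"
          by (rule Fpow_subset[OF Fpow_Union[OF \<F>]]) blast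
        ultimately show ?thesis unfolding selectors_def by blast
      qed
      then obtain G' where "G' \<in> \<G>" "G' \<subseteq> {p \<in> \<Union>\<F>. x \<in> p}"
        using cross unfolding cross_def by blast
      then show "x \<in> (\<Union>G'\<in>\<G>. topspace X \<inter> \<Inter>G')" using x by blast
    qed
    show "finite \<G>" "G \<subseteq> S" using \<G> G by (simp_all add: Fpow_def)
    show "compact_cover X G' G" if "G' \<in> \<G>" for G' using G'[OF that] .
  qed
qed

text \<open>
  Given an interpolating union \<open>\<Union>H\<in>\<G>. \<Inter>H\<close>, the matching family \<open>\<F>\<close> consists of the selectors of \<open>\<G>\<close>
  inside \<open>\<Union>\<G>\<close>: each has a union above the interpolant, and a set \<open>L\<close> containing no \<open>H \<in> \<G>\<close> misses
  the selector \<open>\<Union>\<G> - L\<close>, so that \<open>\<F>\<close> crosses \<open>\<G>\<close>.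
\<close>

lemma compact_cover_interpolation:
  assumes core: "core_compact_space X" and sub: "subbasis_of X S"
    and G: "G \<in> Fpow S" and FG: "compact_cover X F G"
  shows "cut_comp S (compact_cover X) (single_ent (compact_cover X)) F G"
proof -
  have op: "openin X g" if "g \<in> G" for g
    using subbasis_openin[OF sub] G that by (auto simp: Fpow_def)
  have "\<exists>\<G>\<in>Fpow (Fpow S). (\<forall>H\<in>\<G>. \<exists>g\<in>G. compactly_below X (topspace X \<inter> \<Inter>H) g) \<and>
      compactly_below X (topspace X \<inter> \<Inter>F) (\<Union>H\<in>\<G>. topspace X \<inter> \<Inter>H)"
    by (rule subbasis_interpolation[OF core sub op FG[unfolded compact_cover_def]])
  then obtain \<G> where \<G>: "\<G> \<in> Fpow (Fpow S)"
      "\<forall>H\<in>\<G>. \<exists>g\<in>G. compactly_below X (topspace X \<inter> \<Inter>H) g"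
      "compactly_below X (topspace X \<inter> \<Inter>F) (\<Union>H\<in>\<G>. topspace X \<inter> \<Inter>H)"
    by meson
  define \<F> where "\<F> = {K \<in> selectors S \<G>. K \<subseteq> \<Union>\<G>}"
  have UG: "\<Union>\<G> \<in> Fpow S" using Fpow_Union[OF \<G>(1)] .
  have "\<F> \<in> Fpow (Fpow S)"
  proof -
    have "finite (Pow (\<Union>\<G>))" "\<F> \<subseteq> Pow (\<Union>\<G>)" using UG by (auto simp: Fpow_def \<F>_def)
    then have "finite \<F>" by (rule rev_finite_subset)
    then show ?thesis by (auto simp: Fpow_def \<F>_def selectors_def)
  qed
  moreover have "cross S \<F> \<G>"
    unfolding cross_def
  proof (intro ballI, rule ccontr)
    fix L assume L: "L \<in> selectors S \<F>" and none: "\<not> (\<exists>G\<in>\<G>. G \<subseteq> L)"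
    have "\<Union>\<G> - L \<in> Fpow S" using Fpow_subset[OF UG] by blast
    moreover have "(\<Union>\<G> - L) \<inter> H \<noteq> {}" if "H \<in> \<G>" for H using none that by blast
    ultimately have "\<Union>\<G> - L \<in> \<F>" by (simp add: \<F>_def selectors_def)
    then have "L \<inter> (\<Union>\<G> - L) \<noteq> {}" using L unfolding selectors_def by blast
    then show False by blast
  qed
  moreover have "compact_cover X F K" if K: "K \<in> \<F>" for K
    unfolding compact_cover_def
  proof (rule compactly_below_mono[OF \<G>(3) order_refl])
    show "(\<Union>H\<in>\<G>. topspace X \<inter> \<Inter>H) \<subseteq> \<Union>K"
    proof
      fix x assume "x \<in> (\<Union>H\<in>\<G>. topspace X \<inter> \<Inter>H)"
      then obtain H where "H \<in> \<G>" "x \<in> \<Inter>H" by blast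
      moreover from this K have "K \<inter> H \<noteq> {}" by (simp add: \<F>_def selectors_def)
      ultimately show "x \<in> \<Union>K" by blast
    qed
    show "\<Union>K \<subseteq> topspace X"
      using K openin_subset[OF subbasis_openin_Union[OF sub]]
      by (simp add: \<F>_def selectors_def Fpow_def)
  qed
  moreover have "single_ent (compact_cover X) H G" if "H \<in> \<G>" for H
    using \<G>(2) that by (auto simp: single_ent_def compact_cover_def)
  ultimately show ?thesis using \<G>(1) unfolding cut_comp_def by blast
qed

lemma strong_idempotent_compact_cover:
  assumes "core_compact_space X" "subbasis_of X S"
  shows "strong_idempotent S (compact_cover X)"
  unfolding strong_idempotent_def
proof (intro conjI ballI impI)
  show "monotone_ent S (compact_cover X)"
    unfolding monotone_ent_def
  proof (intro ballI impI, elim conjE)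
    fix F G F' G' assume "G' \<in> Fpow S" "compact_cover X F G" "F \<subseteq> F'" "G \<subseteq> G'"
    then show "compact_cover X F' G'"
      using compact_cover_mono[OF assms(2)] by (simp add: Fpow_def)
  qed
qed (use assms compact_cover_cut compact_cover_interpolation in blast)+

text \<open>
  A point \<open>x\<close> of \<open>\<Inter>F\<close> has a neighbourhood \<open>\<Inter>L\<close>, with \<open>L \<subseteq> S\<close> finite, compactly below each \<open>f \<in> F\<close>, and
  the hypothesis applied to \<open>L\<close> puts \<open>x\<close> into \<open>\<Union>H\<close>. The auxiliary subbasic set \<open>s\<close> around \<open>x\<close>
  guarantees that \<open>L\<close> is bounded even if \<open>F\<close> is empty.
\<close>

lemma double_ent_compact_cover_imp_subset:
  assumes core: "core_compact_space X" and sub: "subbasis_of X S"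
    and F: "F \<in> Fpow S" and H: "H \<in> Fpow S" and ent: "double_ent S (compact_cover X) F H"
  shows "topspace X \<inter> \<Inter>F \<subseteq> \<Union>H"
proof
  fix x assume x: "x \<in> topspace X \<inter> \<Inter>F"
  have "x \<in> \<Union>S" using x sub by (simp add: subbasis_of_def)
  then obtain s where s: "s \<in> S" "x \<in> s" by blast
  have "\<exists>K\<in>Fpow S. x \<in> \<Inter>K \<and> compact_cover X K {f}" if "f \<in> insert s F" for f
  proof -
    have "f \<in> S" "x \<in> f" using that s x F by (auto simp: Fpow_def)
    then have "openin X f" by (intro subbasis_openin[OF sub])
    from subbasis_core_nbhd[OF core sub this \<open>x \<in> f\<close>] show ?thesis by (simp add: compact_cover_def)
  qed
  then obtain K where K: "\<And>f. f \<in> insert s F \<Longrightarrow> K f \<in> Fpow S \<and> x \<in> \<Inter>(K f) \<and> compact_cover X (K f) {f}"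
    by metis
  define L where "L = (\<Union>f\<in>insert s F. K f)"
  have "finite (insert s F)" using F by (simp add: Fpow_def)
  then have L: "L \<in> Fpow S" unfolding L_def by (rule Fpow_UN) (use K in blast)
  have Lf: "compact_cover X L {f}" if "f \<in> insert s F" for f
  proof (rule compact_cover_mono[OF sub _ _ order_refl])
    show "compact_cover X (K f) {f}" using K that by blast
    show "K f \<subseteq> L" using that by (auto simp: L_def)
    show "{f} \<subseteq> S" using that s F by (auto simp: Fpow_def)
  qed
  have "{s} \<in> Fpow S" using s by (simp add: Fpow_def)
  then have "L \<in> bounded_sets S (compact_cover X)"
    using L Lf[of s] unfolding bounded_sets_def by blast
  then have "compact_cover X L H" using ent Lf unfolding double_ent_def by blast
  then have "topspace X \<inter> \<Inter>L \<subseteq> \<Union>H"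
    using compact_cover_imp_subset[OF sub] H by (simp add: Fpow_def)
  moreover have "x \<in> \<Inter>L" using K unfolding L_def by blast
  ultimately show "x \<in> \<Union>H" using x by blast
qed

lemma cover_relation_compact_cover:
  assumes core: "core_compact_space X" and sub: "subbasis_of X S"
  shows "cover_relation S (compact_cover X)"
  unfolding cover_relation_def
proof (intro conjI ballI impI strong_idempotent_compact_cover[OF core sub], elim conjE)
  fix F G H assume F: "F \<in> Fpow S" and G: "G \<in> Fpow S" and H: "H \<in> Fpow S"
    and ent: "double_ent S (compact_cover X) F H" and cov: "\<forall>h\<in>H. compact_cover X ({h} \<union> F) G"
  have le: "topspace X \<inter> \<Inter>F \<subseteq> \<Union>H"
    using double_ent_compact_cover_imp_subset[OF core sub F H ent] .
  have "topspace X \<inter> \<Inter>F \<subseteq> (\<Union>h\<in>H. topspace X \<inter> \<Inter>({h} \<union> F))"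
  proof
    fix x assume x: "x \<in> topspace X \<inter> \<Inter>F"
    then obtain h where "h \<in> H" "x \<in> h" using le by blast
    with x show "x \<in> (\<Union>h\<in>H. topspace X \<inter> \<Inter>({h} \<union> F))" by auto
  qed
  moreover have "finite H" "G \<subseteq> S" using H G by (simp_all add: Fpow_def)
  ultimately show "compact_cover X F G"
    using compact_cover_UN[OF sub, of H G F "\<lambda>h. {h} \<union> F"] cov by blast
qed

lemma antisymmetric_cover_system_compact_cover:
  assumes core: "core_compact_space X" and sub: "subbasis_of X S"
  shows "antisymmetric_cover_system S (compact_cover X)"
  unfolding antisymmetric_cover_system_def
proof (intro conjI ballI impI cover_relation_compact_cover[OF core sub], elim conjE)
  fix p q assume pq: "p \<in> S" "q \<in> S"
    and ent: "double_ent S (compact_cover X) {p} {q}" "double_ent S (compact_cover X) {q} {p}"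
  have "{p} \<in> Fpow S" "{q} \<in> Fpow S" using pq by (simp_all add: Fpow_def)
  then have "topspace X \<inter> p \<subseteq> q" "topspace X \<inter> q \<subseteq> p"
    using double_ent_compact_cover_imp_subset[OF core sub] ent by fastforce+
  moreover have "p \<subseteq> topspace X" "q \<subseteq> topspace X"
    using pq subbasis_openin[OF sub] openin_subset by blast+
  ultimately show "p = q" by blast
qed

section \<open>Recovering a space from a subbasis\<close>

lemma point_is_tight:
  assumes core: "core_compact_space X" and sub: "subbasis_of X S" and x: "x \<in> topspace X"
  shows "{p \<in> S. x \<in> p} \<in> tight_points S (compact_cover X)"
proof -
  let ?T = "{p \<in> S. x \<in> p}"
  have "x \<in> \<Union>S" using x sub by (simp add: subbasis_of_def)
  then have "?T \<noteq> {}" by blast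
  moreover have "?T \<inter> G \<noteq> {}" if G: "G \<in> Fpow S" and F: "F \<in> Fpow ?T" "compact_cover X F G" for F G
  proof -
    have "G \<subseteq> S" using G by (simp add: Fpow_def)
    then have "topspace X \<inter> \<Inter>F \<subseteq> \<Union>G" using compact_cover_imp_subset[OF sub F(2)] by blast
    moreover have "x \<in> topspace X \<inter> \<Inter>F" using F(1) x by (auto simp: Fpow_def)
    ultimately show ?thesis using \<open>G \<subseteq> S\<close> by blast
  qed
  moreover have "\<exists>F\<in>Fpow ?T. compact_cover X F G" if G: "G \<in> Fpow S" and meet: "?T \<inter> G \<noteq> {}" for G
  proof -
    obtain g where g: "g \<in> G" "g \<in> S" "x \<in> g" using meet by blast
    obtain F where F: "F \<in> Fpow S" "x \<in> \<Inter>F" "compactly_below X (topspace X \<inter> \<Inter>F) g"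
      using subbasis_core_nbhd[OF core sub subbasis_openin[OF sub g(2)] g(3)] by blast
    have "compact_cover X F {g}" using F(3) by (simp add: compact_cover_def)
    then have "compact_cover X F G"
      by (rule compact_cover_mono[OF sub]) (use g G in \<open>auto simp: Fpow_def\<close>)
    moreover have "F \<in> Fpow ?T" using F by (auto simp: Fpow_def)
    ultimately show ?thesis by blast
  qed
  ultimately show ?thesis unfolding tight_points_def tight_def by blast
qed

lemma core_coherent_Inter:
  assumes coh: "core_coherent_space X" and op: "openin X p" and "finite F" "F \<noteq> {}"
    and "\<And>f. f \<in> F \<Longrightarrow> openin X f \<and> compactly_below X p f"
  shows "openin X (\<Inter>F) \<and> compactly_below X p (\<Inter>F)"
  using assms(3-)
proof (induction F rule: finite_ne_induct)
  case (insert f F)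
  then have f: "openin X f" "compactly_below X p f"
    and F: "openin X (\<Inter>F)" "compactly_below X p (\<Inter>F)" by simp_all
  have "openin X p" by (fact op)
  then have "compactly_below X p (f \<inter> \<Inter>F)"
    using coh f F unfolding core_coherent_space_def by meson
  with f F show ?case by (simp add: openin_Int)
qed simp

text \<open>
  Sobriety is applied to the set \<open>C\<close> of points that lie in no subbasic set outside \<open>T\<close>. That
  \<open>\<Inter>F\<close> meets \<open>C\<close> for finite \<open>F \<subseteq> T\<close> gives both irreducibility of \<open>C\<close> and the
  description of \<open>T\<close> by the generic point. To see it, choose a finite \<open>K \<subseteq> T\<close> with \<open>\<Inter>K\<close> compactly below each
  \<open>f \<in> F\<close>, hence below \<open>\<Inter>F\<close> by coherence; if \<open>\<Inter>F\<close> were inside \<open>\<Union>(S - T)\<close>, then \<open>K\<close> would entail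
  a finite set disjoint from \<open>T\<close>.
\<close>

lemma tight_is_point:
  assumes slc: "stably_locally_compact_space X" and sub: "subbasis_of X S"
    and T: "T \<in> tight_points S (compact_cover X)"
  shows "\<exists>x\<in>topspace X. T = {p \<in> S. x \<in> p}"
proof -
  have core: "core_compact_space X" and coh: "core_coherent_space X" and sober: "sober_space X"
    using slc by (simp_all add: stably_locally_compact_space_def)
  have TS: "T \<subseteq> S" using tight_pointsD(2)[OF T] .
  define U where "U = \<Union>(S - T)"
  define C where "C = topspace X - U"
  have CD: "p \<in> T" if "x \<in> C" "p \<in> S" "x \<in> p" for x p
    using that by (auto simp: C_def U_def)
  have "openin X U" unfolding U_def using subbasis_openin_Union[OF sub] by blast
  then have clo: "closedin X C" unfolding C_def by blast
  have meets: "topspace X \<inter> \<Inter>F \<inter> C \<noteq> {}" if F: "F \<in> Fpow T" "F \<noteq> {}" for F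
  proof
    assume disj: "topspace X \<inter> \<Inter>F \<inter> C = {}"
    have FS: "F \<subseteq> S" "finite F" "F \<subseteq> T" using F TS by (auto simp: Fpow_def)
    obtain E where E: "\<And>f. f \<in> F \<Longrightarrow> E f \<in> Fpow T \<and> compact_cover X (E f) {f}"
      using tight_pointsD(4)[OF T] FS(3) by (metis subsetD)
    define K where "K = (\<Union>f\<in>F. E f)"
    have K: "K \<in> Fpow T" unfolding K_def by (rule Fpow_UN[OF FS(2)]) (use E in blast)
    have "openin X f \<and> compactly_below X (topspace X \<inter> \<Inter>K) f" if f: "f \<in> F" for f
    proof
      have "compact_cover X K {f}"
      proof (rule compact_cover_mono[OF sub _ _ order_refl])
        show "compact_cover X (E f) {f}" using E f by blast
        show "E f \<subseteq> K" using f by (auto simp: K_def)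
        show "{f} \<subseteq> S" using f FS by blast
      qed
      then show "compactly_below X (topspace X \<inter> \<Inter>K) f" by (simp add: compact_cover_def)
      show "openin X f" using f FS subbasis_openin[OF sub] by blast
    qed
    moreover have "openin X (topspace X \<inter> \<Inter>K)"
      using subbasis_openin_Inter[OF sub] K TS by (auto simp: Fpow_def)
    ultimately have "openin X (\<Inter>F) \<and> compactly_below X (topspace X \<inter> \<Inter>K) (\<Inter>F)"
      using core_coherent_Inter[OF coh _ FS(2) F(2)] by blast
    then
    have "openin X (\<Inter>F)" "compactly_below X (topspace X \<inter> \<Inter>K) (\<Inter>F)" by simp_all
    moreover have "\<Inter>F \<subseteq> topspace X" using openin_subset[OF \<open>openin X (\<Inter>F)\<close>] .
    then have "\<Inter>F \<subseteq> U" using disj unfolding C_def by blast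
    ultimately have "compactly_below X (topspace X \<inter> \<Inter>K) (\<Union>(S - T))"
      using compactly_below_mono[OF _ order_refl _ openin_subset[OF \<open>openin X U\<close>]]
      unfolding U_def by metis
    moreover have "openin X V" if "V \<in> S - T" for V using that subbasis_openin[OF sub] by blast
    ultimately obtain G where G: "G \<subseteq> S - T" "finite G" "compact_cover X K G"
      using core_compact_finite_subfamily[OF core] unfolding compact_cover_def by metis
    then have "G \<in> Fpow S" by (auto simp: Fpow_def)
    then have "T \<inter> G \<noteq> {}" using tight_pointsD(3)[where R = "compact_cover X", OF T K] G by blast
    with G show False by blast
  qed
  obtain t where "t \<in> T" using tight_pointsD(1)[OF T] by blast
  then have "C \<noteq> {}" using meets[of "{t}"] by (auto simp: Fpow_def)
  have "A \<inter> B \<inter> C \<noteq> {}"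
    if op: "openin X A" "openin X B" and ne: "A \<inter> C \<noteq> {}" "B \<inter> C \<noteq> {}" for A B
  proof -
    obtain x y where x: "x \<in> A" "x \<in> C" and y: "y \<in> B" "y \<in> C" using ne by blast
    obtain H where H: "H \<in> Fpow S" "H \<noteq> {}" "x \<in> \<Inter>H" "\<Inter>H \<subseteq> A"
      using subbasis_basic_nbhd[OF sub op(1) x(1)] by blast
    obtain K where K: "K \<in> Fpow S" "y \<in> \<Inter>K" "\<Inter>K \<subseteq> B"
      using subbasis_basic_nbhd[OF sub op(2) y(1)] by blast
    have "H \<union> K \<in> Fpow T" using H K CD[OF x(2)] CD[OF y(2)] by (auto simp: Fpow_def)
    then have "topspace X \<inter> \<Inter>(H \<union> K) \<inter> C \<noteq> {}" using meets H(2) by blast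
    moreover have "\<Inter>(H \<union> K) \<subseteq> A \<inter> B" using H(4) K(3) by (simp add: Inter_Un_distrib) blast
    ultimately show ?thesis by blast
  qed
  with clo \<open>C \<noteq> {}\<close> have "irreducible_closedin X C"
    unfolding irreducible_closedin_iff by simp
  then obtain x where x: "x \<in> topspace X" "C = X closure_of {x}"
    using sober unfolding sober_space_def by blast
  have "x \<in> C" using x by (simp add: in_closure_of)
  have "T = {p \<in> S. x \<in> p}"
  proof
    show "{p \<in> S. x \<in> p} \<subseteq> T" using CD[OF \<open>x \<in> C\<close>] by blast
    show "T \<subseteq> {p \<in> S. x \<in> p}"
    proof
      fix p assume p: "p \<in> T"
      then obtain y where "y \<in> p" "y \<in> C" using meets[of "{p}"] by (auto simp: Fpow_def)
      moreover have "openin X p" using p TS subbasis_openin[OF sub] by blast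
      ultimately have "x \<in> p" using x(2) by (auto simp: in_closure_of)
      with p TS show "p \<in> {p \<in> S. x \<in> p}" by blast
    qed
  qed
  with x show ?thesis by blast
qed

lemma homeomorphic_map_to_tight_spectrum:
  assumes slc: "stably_locally_compact_space X" and sub: "subbasis_of X S"
  shows "homeomorphic_map X (tight_spectrum S (compact_cover X)) (\<lambda>x. {p \<in> S. x \<in> p})"
    (is "homeomorphic_map X ?Y ?\<phi>")
proof -
  have core: "core_compact_space X" and sober: "sober_space X"
    using slc by (simp_all add: stably_locally_compact_space_def)
  have gen: "topology_generated_by S = X" and top: "\<Union>S = topspace X"
    using sub by (simp_all add: subbasis_of_def)
  have topY: "topspace ?Y = tight_points S (compact_cover X)" by (rule topspace_tight_spectrum)
  define \<psi> where "\<psi> = inv_into (topspace X) ?\<phi>"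
  have inj: "inj_on ?\<phi> (topspace X)"
  proof (rule inj_onI)
    fix x y assume xy: "x \<in> topspace X" "y \<in> topspace X" "?\<phi> x = ?\<phi> y"
    have le: "v \<in> U" if eq: "?\<phi> u = ?\<phi> v" and U: "openin X U" "u \<in> U" for u v U
    proof -
      obtain H where H: "H \<in> Fpow S" "u \<in> \<Inter>H" "\<Inter>H \<subseteq> U"
        using subbasis_basic_nbhd[OF sub U] by blast
      then have "H \<subseteq> ?\<phi> u" by (auto simp: Fpow_def)
      then have "v \<in> \<Inter>H" using eq by auto
      with H show ?thesis by blast
    qed
    show "x = y"
      using sober_points_eqI[OF sober xy(1,2)] le[OF xy(3)] le[OF xy(3)[symmetric]] by blast
  qed
  have img: "?\<phi> ` topspace X = topspace ?Y"
    unfolding topY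
  proof
    show "?\<phi> ` topspace X \<subseteq> tight_points S (compact_cover X)"
      using point_is_tight[OF core sub] by blast
    show "tight_points S (compact_cover X) \<subseteq> ?\<phi> ` topspace X"
      using tight_is_point[OF slc sub] by blast
  qed
  have \<psi>\<phi>: "\<psi> (?\<phi> x) = x" if "x \<in> topspace X" for x
    using inv_into_f_f[OF inj that] by (simp add: \<psi>_def)
  have \<phi>\<psi>: "?\<phi> (\<psi> T) = T" and \<psi>_in: "\<psi> T \<in> topspace X" if "T \<in> topspace ?Y" for T
    using that f_inv_into_f[of T ?\<phi> "topspace X"] inv_into_into[of T ?\<phi> "topspace X"] img
    by (simp_all add: \<psi>_def)
  have "continuous_map X ?Y ?\<phi>"
    unfolding tight_spectrum_def continuous_on_generated_topo_iff
  proof (intro conjI allI impI)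
    fix V assume "V \<in> tight_nbhd S (compact_cover X) ` S"
    then obtain p where p: "p \<in> S" "V = tight_nbhd S (compact_cover X) p" by blast
    then have "?\<phi> -` V \<inter> topspace X = p"
      using point_is_tight[OF core sub] openin_subset[OF subbasis_openin[OF sub p(1)]]
      by (auto simp: tight_nbhd_def)
    then show "openin X (?\<phi> -` V \<inter> topspace X)" using subbasis_openin[OF sub p(1)] by simp
  next
    show "?\<phi> ` topspace X \<subseteq> \<Union>(tight_nbhd S (compact_cover X) ` S)"
      using img by (simp add: tight_spectrum_def)
  qed
  moreover have "continuous_map ?Y (topology_generated_by S) \<psi>"
    unfolding continuous_on_generated_topo_iff
  proof (intro conjI allI impI)
    fix p assume p: "p \<in> S"
    have "T \<in> \<psi> -` p \<inter> topspace ?Y \<longleftrightarrow> T \<in> tight_nbhd S (compact_cover X) p" for T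
    proof (cases "T \<in> topspace ?Y")
      case True
      then have "\<psi> T \<in> p \<longleftrightarrow> p \<in> T" using \<phi>\<psi>[OF True] p by blast
      then show ?thesis using True by (simp add: tight_nbhd_def topY)
    next
      case False
      then show ?thesis by (simp add: tight_nbhd_def topY)
    qed
    then have "\<psi> -` p \<inter> topspace ?Y = tight_nbhd S (compact_cover X) p" by blast
    then show "openin ?Y (\<psi> -` p \<inter> topspace ?Y)" using openin_tight_nbhd[OF p] by simp
  next
    show "\<psi> ` topspace ?Y \<subseteq> \<Union>S" using \<psi>_in top by blast
  qed
  ultimately have "homeomorphic_maps X ?Y ?\<phi> \<psi>"
    using \<psi>\<phi> \<phi>\<psi> gen by (simp add: homeomorphic_maps_def)
  then show ?thesis by (simp add: homeomorphic_maps_map)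
qed

lemma stably_locally_compact_tight_spectrum:
  assumes "strong_idempotent S R"
  shows "stably_locally_compact_space (tight_spectrum S R)"
  using assms core_compact_tight_spectrum core_coherent_tight_spectrum sober_tight_spectrum
  unfolding stably_locally_compact_space_def by blast

theorem theorem3p15:
  shows "(\<forall>(X :: 'b topology) (S :: 'b set set).
            stably_locally_compact_space X \<and> subbasis_of X S \<longrightarrow>
              antisymmetric_cover_system S (compact_cover X) \<and>
              homeomorphic_map X (tight_spectrum S (compact_cover X)) (\<lambda>x. {p \<in> S. x \<in> p}))
       \<and> (\<forall>(S :: 'a set) (R :: 'a set \<Rightarrow> 'a set \<Rightarrow> bool).
            antisymmetric_cover_system S R \<longrightarrow>
              stably_locally_compact_space (tight_spectrum S R) \<and>
              inj_on (tight_nbhd S R) S \<and>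
              subbasis_of (tight_spectrum S R) (tight_nbhd S R ` S) \<and>
              (\<forall>F\<in>Fpow S. \<forall>G\<in>Fpow S.
                 R F G \<longleftrightarrow>
                   compactly_below (tight_spectrum S R)
                     (topspace (tight_spectrum S R) \<inter> (\<Inter>f\<in>F. tight_nbhd S R f))
                     (\<Union>g\<in>G. tight_nbhd S R g)))"
proof (intro conjI allI impI, elim conjE)
  fix X :: "'b topology" and S
  assume "stably_locally_compact_space X" and sub: "subbasis_of X S"
  then have "core_compact_space X" by (simp add: stably_locally_compact_space_def)
  then show "antisymmetric_cover_system S (compact_cover X)"
    using sub by (rule antisymmetric_cover_system_compact_cover)
next
  fix X :: "'b topology" and S
  assume "stably_locally_compact_space X \<and> subbasis_of X S"
  then show "homeomorphic_map X (tight_spectrum S (compact_cover X)) (\<lambda>x. {p \<in> S. x \<in> p})"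
    using homeomorphic_map_to_tight_spectrum by blast
next
  fix S :: "'a set" and R
  assume sys: "antisymmetric_cover_system S R"
  then have cov: "cover_relation S R" by (simp add: antisymmetric_cover_system_def)
  then have "strong_idempotent S R" by (simp add: cover_relation_def)
  then show "stably_locally_compact_space (tight_spectrum S R)"
    by (rule stably_locally_compact_tight_spectrum)
  show "inj_on (tight_nbhd S R) S" using inj_on_tight_nbhd[OF sys] .
  show "subbasis_of (tight_spectrum S R) (tight_nbhd S R ` S)" by (rule subbasis_of_tight_spectrum)
  show "\<forall>F\<in>Fpow S. \<forall>G\<in>Fpow S.
      R F G \<longleftrightarrow>
        compactly_below (tight_spectrum S R)
          (topspace (tight_spectrum S R) \<inter> (\<Inter>f\<in>F. tight_nbhd S R f))
          (\<Union>g\<in>G. tight_nbhd S R g)"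
    using entails_iff_compactly_below[OF cov] by (simp add: tight_box_eq)
qed

end
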